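(* For any positive integers $k$ and $n$ and any non-negative integer $r\le 2k$, there is a $(k+1)$-neighborly family of $n$ congruent convex polytopes in $\mathbb{R}^{2k+1}$, each of which is symmetric about an $r$-flat.
   Context: A convex polytope in $\mathbb{R}^d$ is a bounded intersection of finitely many closed halfspaces with nonempty interior. Polytopes are congruent if each is the image of any other under an isometry of $\mathbb{R}^d$. A family of convex polyhedra (in particular, polytopes) in $\mathbb{R}^d$ is (strictly) $j$-neighborly if any subset of $j$ of the polyhedra has a $(d-j+1)$-dimensional intersection, and no subset of $j+1$ of them has a non-empty intersection. An $r$-flat is an $r$-dimensional affine subspace. A set is symmetric about a flat $f$ if it is mapped to itself by the reflection across $f$, i.e. the isometry that fixes $f$ pointwise and acts as $-1$ on the directions orthogonal to $f$. *)

theory Defs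
  imports "HOL-Analysis.Analysis"
begin

definition convex_polytope :: "'a::euclidean_space set \<Rightarrow> bool" where
  "convex_polytope P \<longleftrightarrow> polyhedron P \<and> bounded P \<and> interior P \<noteq> {}"

text \<open>Surjectivity is automatic in finite dimension.\<close>

definition isometry :: "('a::euclidean_space \<Rightarrow> 'a) \<Rightarrow> bool" where
  "isometry g \<longleftrightarrow> (\<forall>x y. dist (g x) (g y) = dist x y)"

definition congruent_sets :: "'a::euclidean_space set \<Rightarrow> 'a set \<Rightarrow> bool" where
  "congruent_sets P Q \<longleftrightarrow> (\<exists>g. isometry g \<and> g ` P = Q)"

text \<open>Families are sets of polyhedra, so the members of a family are pairwise distinct. The
  dimension is computed in the integers, to avoid truncated subtraction.\<close>

definition neighborly :: "nat \<Rightarrow> 'a::euclidean_space set set \<Rightarrow> bool" where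
  "neighborly j F \<longleftrightarrow>
     (\<forall>S. S \<subseteq> F \<and> finite S \<and> card S = j \<longrightarrow> aff_dim (\<Inter>S) = int DIM('a) - int j + 1) \<and>
     (\<forall>S. S \<subseteq> F \<and> finite S \<and> card S = j + 1 \<longrightarrow> \<Inter>S = {})"

definition flat :: "nat \<Rightarrow> 'a::euclidean_space set \<Rightarrow> bool" where
  "flat r f \<longleftrightarrow> affine f \<and> aff_dim f = int r"

definition reflection_across :: "'a::euclidean_space set \<Rightarrow> ('a \<Rightarrow> 'a) \<Rightarrow> bool" where
  "reflection_across f \<rho> \<longleftrightarrow> isometry \<rho> \<and> (\<forall>p\<in>f. \<rho> p = p) \<and>
     (\<forall>p\<in>f. \<forall>v. (\<forall>x\<in>f. \<forall>y\<in>f. orthogonal v (x - y)) \<longrightarrow> \<rho> (p + v) = p - v)"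

definition symmetric_about :: "'a::euclidean_space set \<Rightarrow> 'a set \<Rightarrow> bool" where
  "symmetric_about P f \<longleftrightarrow> (\<exists>\<rho>. reflection_across f \<rho> \<and> \<rho> ` P = P)"

text \<open>The reflection exists and is unique, so the quantifier over \<open>\<rho>\<close> above
  leaves no freedom.\<close>

lemma reflection_across_ex1:
  fixes f :: "'a::euclidean_space set"
  assumes "flat r f"
  shows "\<exists>!\<rho>. reflection_across f \<rho>"
proof -
  have aff: "affine f" and ne: "f \<noteq> {}"
    using assms by (auto simp: flat_def)
  then obtain a where a: "a \<in> f" by blast
  define D where "D = (\<lambda>x. - a + x) ` f"
  have D: "subspace D"
    unfolding D_def using affine_diffs_subspace[OF aff a] by simp
  have Df: "a + y \<in> f \<longleftrightarrow> y \<in> D" for y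
    unfolding D_def by force
  have orth_iff: "(\<forall>x\<in>f. \<forall>y\<in>f. orthogonal v (x - y)) \<longleftrightarrow> (\<forall>y\<in>D. orthogonal v y)" for v
  proof
    assume L: "\<forall>x\<in>f. \<forall>y\<in>f. orthogonal v (x - y)"
    show "\<forall>y\<in>D. orthogonal v y"
    proof
      fix y assume "y \<in> D"
      then have "a + y \<in> f" by (simp add: Df)
      with L a have "orthogonal v (a + y - a)" by blast
      then show "orthogonal v y" by simp
    qed
  next
    assume R: "\<forall>y\<in>D. orthogonal v y"
    show "\<forall>x\<in>f. \<forall>y\<in>f. orthogonal v (x - y)"
    proof (intro ballI)
      fix x y assume "x \<in> f" "y \<in> f"
      then have "x - a \<in> D" "y - a \<in> D" by (simp_all add: Df[symmetric])
      then have "(x - a) - (y - a) \<in> D" by (rule subspace_diff[OF D])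
      then show "orthogonal v (x - y)" using R by auto
    qed
  qed
  have decomp: "\<exists>y z. y \<in> D \<and> (\<forall>w\<in>D. orthogonal z w) \<and> x = y + z" for x
    using orthogonal_subspace_decomp_exists[of D x] D by (metis span_eq_iff)
  then obtain Y Z where YZ: "\<And>x. Y x \<in> D" "\<And>x w. w \<in> D \<Longrightarrow> orthogonal (Z x) w" "\<And>x. x = Y x + Z x"
    by metis
  have eqn: "\<rho> x = a + Y (x - a) - Z (x - a)" if "reflection_across f \<rho>" for \<rho> x
  proof -
    have "\<rho> ((a + Y (x - a)) + Z (x - a)) = (a + Y (x - a)) - Z (x - a)"
      using that YZ(1,2) unfolding reflection_across_def orth_iff by (simp add: Df)
    moreover have "(a + Y (x - a)) + Z (x - a) = x"
      using YZ(3)[of "x - a"] by (simp add: algebra_simps)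
    ultimately show ?thesis by simp
  qed
  have uniq: "y = Y x \<and> z = Z x" if "y \<in> D" "\<forall>w\<in>D. orthogonal z w" "x = y + z" for x y z
  proof -
    have d: "y - Y x = Z x - z" using YZ(3)[of x] that(3) by (simp add: algebra_simps)
    have "y - Y x \<in> D" using that(1) YZ(1) by (rule subspace_diff[OF D])
    then have "inner (Z x - z) (y - Y x) = 0"
      using that(2) YZ(2) by (simp add: orthogonal_def inner_diff_left)
    then show ?thesis using d by simp
  qed
  define R where "R = (\<lambda>x. a + Y (x - a) - Z (x - a))"
  have "reflection_across f R"
    unfolding reflection_across_def orth_iff isometry_def
  proof (intro conjI allI impI ballI)
    fix x y :: 'a
    define s t where "s = Y (x - a) - Y (y - a)" and "t = Z (x - a) - Z (y - a)"
    have "s \<in> D" unfolding s_def using YZ(1) YZ(1) by (rule subspace_diff[OF D])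
    then have o: "inner t s = 0"
      using YZ(2) by (simp add: t_def orthogonal_def inner_diff_left)
    have "R x - R y = s - t" by (simp add: R_def s_def t_def)
    moreover have "x - y = s + t"
      using YZ(3)[of "x - a"] YZ(3)[of "y - a"] unfolding s_def t_def
      by (smt (verit) add_diff_add diff_add_cancel add_diff_cancel_left' diff_diff_eq2)
    ultimately show "dist (R x) (R y) = dist x y"
      using o by (simp add: dist_norm norm_eq_sqrt_inner inner_diff inner_add inner_commute)
  next
    have main: "R (p + v) = p - v" if "p \<in> f" "\<forall>y\<in>D. orthogonal v y" for p v
    proof -
      have "p - a \<in> D" using that(1) by (simp add: Df[symmetric])
      then have "p - a = Y (p + v - a) \<and> v = Z (p + v - a)"
        using uniq[of "p - a" v "p + v - a"] that(2) by (simp add: algebra_simps)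
      then have "Y (p + v - a) = p - a" "Z (p + v - a) = v" by simp_all
      then show ?thesis by (simp add: R_def)
    qed
    fix p assume p: "p \<in> f"
    show "R p = p" using main[OF p, of 0] by (simp add: orthogonal_def)
    fix v assume "\<forall>y\<in>D. orthogonal v y"
    then show "R (p + v) = p - v" by (rule main[OF p])
  qed
  then show ?thesis
    using eqn by (metis ext)
qed

end

theory Submission
  imports Defs
begin

text \<open>The polytopes are truncated Voronoi regions of equally spaced points on the helix
  \<open>curve t = (t, cos t, sin t, \<dots>, cos k t, sin k t)\<close>, each region taking into account only finitely
  many neighbours so that all regions are congruent under the screw motions of the helix. For fixed
  \<open>x\<close>, the function \<open>F t = (dist x (curve t))\<^sup>2 - R\<^sup>2\<close> is \<open>t\<^sup>2\<close> plus an affine function plus a trigonometric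
  polynomial of degree \<open>k\<close>, so by Rolle's theorem it has at most \<open>2 * k + 2\<close> zeros, counted with
  multiplicity, on an interval shorter than a period. Prescribing \<open>k + 1\<close> double zeros determines \<open>x\<close> and
  \<open>R\<close>, and then \<open>F\<close> is positive elsewhere, so any \<open>k + 1\<close> regions meet in a subset,
  with nonempty relative interior, of the flat of points equidistant from their centres. Only every third point contributes a member
  of the family: a point of a region is a zero of \<open>F\<close> with \<open>F \<ge> 0\<close> at both neighbours, which accounts
  for two zeros, so \<open>k + 2\<close> members cannot meet. The regions contain a cone with nonempty interior, and
  intersecting a region with its reflection across a flat lying far out in this cone makes it
  symmetric without changing it near the relevant points.\<close>

section \<open>Zeros of trigonometric polynomials with a quadratic term\<close>

definition quad_trig :: "nat \<Rightarrow> real \<Rightarrow> real \<Rightarrow> real \<Rightarrow> (nat \<Rightarrow> real) \<Rightarrow> (nat \<Rightarrow> real) \<Rightarrow> real \<Rightarrow> real" where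
  "quad_trig k c \<alpha> \<beta> a b t =
     c + \<alpha> * t + \<beta> * t\<^sup>2 + (\<Sum>l<k. a l * cos (real (Suc l) * t) + b l * sin (real (Suc l) * t))"

text \<open>The family is closed under differentiation, so a function and its first two derivatives
  are all instances of \<open>quad_trig\<close>; index l carries the frequency l + 1. Two
  derivatives turn the quadratic term into the constant 2 \<beta>, leaving a trigonometric
  polynomial of degree at most k.\<close>

lemma has_real_derivative_quad_trig:
  "(quad_trig k c \<alpha> \<beta> a b has_real_derivative
     quad_trig k \<alpha> (2 * \<beta>) 0 (\<lambda>l. real (Suc l) * b l) (\<lambda>l. - real (Suc l) * a l) t) (at t)"
  unfolding quad_trig_def
  by (auto intro!: derivative_eq_intros sum.cong simp: algebra_simps)

lemma cis_eq_imp_eq: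
  assumes "cis x = cis y" "\<bar>x - y\<bar> < 2 * pi"
  shows "x = y"
proof -
  have "sin x = sin y \<and> cos x = cos y"
    using assms(1) by (simp add: complex_eq_iff)
  then obtain m :: int where m: "x = y + 2 * pi * m"
    using sin_cos_eq_iff[of x y] by blast
  with assms(2) have "\<bar>real_of_int m\<bar> < 1"
    by (simp add: abs_mult)
  then show ?thesis using m by simp
qed

text \<open>Times \<open>cis t ^ k\<close>, the function becomes a complex polynomial of degree at
  most 2 k in \<open>cis t\<close>. Points less than a period apart give distinct roots, so 2 k + 1
  zeros force this polynomial to vanish, and its coefficients determine c, a and b.\<close>

lemma trig_polynomial_eq_0:
  assumes card: "card A \<ge> 2 * k + 1"
    and diam: "\<And>s t. s \<in> A \<Longrightarrow> t \<in> A \<Longrightarrow> \<bar>s - t\<bar> < 2 * pi"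
    and zero: "\<And>t. t \<in> A \<Longrightarrow> quad_trig k c 0 0 a b t = 0"
  shows "c = 0 \<and> (\<forall>l<k. a l = 0 \<and> b l = 0)"
proof -
  define p :: "complex poly" where
    "p = monom (of_real c) k +
       (\<Sum>l<k. monom (Complex (a l) (- b l) / 2) (k + Suc l) + monom (Complex (a l) (b l) / 2) (k - Suc l))"
  have term_eq: "Complex (a l) (- b l) / 2 * cis t ^ (k + Suc l) + Complex (a l) (b l) / 2 * cis t ^ (k - Suc l)
      = cis t ^ k * of_real (a l * cos (real (Suc l) * t) + b l * sin (real (Suc l) * t))"
    if "l < k" for l t
  proof -
    define x where "x = real (Suc l) * t"
    have 1: "cis t ^ (k + Suc l) = cis t ^ k * cis x"
      by (simp only: Complex.DeMoivre x_def power_add)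
    have "real (k - Suc l) = real k - real (Suc l)"
      using that by (subst of_nat_diff) auto
    then have 2: "cis t ^ (k - Suc l) = cis t ^ k * cis (- x)"
      by (simp add: Complex.DeMoivre x_def cis_mult algebra_simps)
    have "Complex (a l) (- b l) / 2 * cis x + Complex (a l) (b l) / 2 * cis (- x)
        = of_real (a l * cos x + b l * sin x)"
      by (auto simp: complex_eq_iff add_divide_distrib diff_divide_distrib)
    moreover have "u * (w * y) + v * (w * z) = w * (u * y + v * z)" for u v w y z :: complex
      by (simp add: algebra_simps)
    ultimately show ?thesis
      unfolding 1 2 x_def[symmetric] by (simp only:)
  qed
  have p_cis: "poly p (cis t) = cis t ^ k * of_real (quad_trig k c 0 0 a b t)" for t
  proof -
    have "poly p (cis t) = of_real c * cis t ^ k + (\<Sum>l<k. Complex (a l) (- b l) / 2 * cis t ^ (k + Suc l) + Complex (a l) (b l) / 2 * cis t ^ (k - Suc l))"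
      unfolding p_def by (simp only: poly_add poly_sum poly_monom)
    also have "\<dots> = of_real c * cis t ^ k + (\<Sum>l<k. cis t ^ k * of_real (a l * cos (real (Suc l) * t) + b l * sin (real (Suc l) * t)))"
      using term_eq by (intro arg_cong2[where f = "(+)"] refl sum.cong) auto
    also have "\<dots> = cis t ^ k * of_real (quad_trig k c 0 0 a b t)"
      unfolding quad_trig_def of_real_add of_real_sum distrib_left sum_distrib_left
      by (simp add: mult.commute)
    finally show ?thesis .
  qed
  have inj: "inj_on cis A"
    by (auto intro!: inj_onI cis_eq_imp_eq diam)
  have "p = 0"
  proof (rule ccontr)
    assume "p \<noteq> 0"
    have "cis ` A \<subseteq> {x. poly p x = 0}"
      using zero by (auto simp: p_cis)
    then have "card A \<le> card {x. poly p x = 0}"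
      using card_mono[OF poly_roots_finite[OF \<open>p \<noteq> 0\<close>]] card_image[OF inj] by metis
    also have "\<dots> \<le> degree p"
      using \<open>p \<noteq> 0\<close> by (rule card_poly_roots_bound)
    also have "degree p \<le> 2 * k"
      unfolding p_def
      by (intro degree_add_le degree_sum_le order.trans[OF degree_monom_le]) auto
    finally show False using card by simp
  qed
  have coeff_p: "poly.coeff p m = (if m = k then of_real c else 0) +
      (\<Sum>l<k. (if k + Suc l = m then Complex (a l) (- b l) / 2 else 0) + (if k - Suc l = m then Complex (a l) (b l) / 2 else 0))" for m
    unfolding p_def coeff_add coeff_sum by (simp add: eq_commute)
  have "poly.coeff p k = of_real c"
    unfolding coeff_p by (auto intro!: sum.neutral)
  moreover have "poly.coeff p (k + Suc l) = Complex (a l) (- b l) / 2" if "l < k" for l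
  proof -
    have "poly.coeff p (k + Suc l) = 0 + (\<Sum>m<k. if m = l then Complex (a m) (- b m) / 2 else 0)"
      unfolding coeff_p by (intro arg_cong2[where f = "(+)"] sum.cong) (use that in auto)
    also have "\<dots> = Complex (a l) (- b l) / 2"
      using that by simp
    finally show ?thesis .
  qed
  ultimately show ?thesis
    using \<open>p = 0\<close> by (auto simp: complex_eq_iff)
qed

text \<open>C is kept disjoint from A so that multiple zeros can be counted: zeros of
  \<open>f'\<close> in A add to those in C. In the induction each new largest point contributes one
  Rolle point beyond \<open>Max A\<close>, which is new because C stays within
  \<open>{Min A..Max A}\<close>.\<close>

lemma Rolle_zeros:
  fixes f f' :: "real \<Rightarrow> real"
  assumes deriv: "\<And>t. (f has_real_derivative f' t) (at t)"
    and "finite A" "A \<noteq> {}" "\<And>t. t \<in> A \<Longrightarrow> f t = 0"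
  shows "\<exists>C. finite C \<and> C \<inter> A = {} \<and> C \<subseteq> {Min A..Max A} \<and> Suc (card C) = card A \<and> (\<forall>t\<in>C. f' t = 0)"
  using assms(2-4)
proof (induction A rule: finite_linorder_max_induct)
  case empty
  then show ?case by simp
next
  case (insert z A)
  show ?case
  proof (cases "A = {}")
    case True
    then show ?thesis by (intro exI[of _ "{}"]) auto
  next
    case False
    obtain C where C: "finite C" "C \<inter> A = {}" "C \<subseteq> {Min A..Max A}" "Suc (card C) = card A" "\<forall>t\<in>C. f' t = 0"
      using insert.IH[OF False] insert.prems by blast
    have M: "Max A \<in> A" "Max A < z"
      using insert.hyps False by auto
    have "\<exists>y>Max A. y < z \<and> DERIV f y :> 0"
    proof (rule Rolle[OF M(2)])
      show "f (Max A) = f z" using insert.prems M by simp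
      show "continuous_on {Max A..z} f"
        using deriv by (intro DERIV_continuous_on) (rule has_field_derivative_at_within)
      show "f differentiable (at x)" for x
        using deriv real_differentiable_def by blast
    qed
    then obtain y where y: "Max A < y" "y < z" "DERIV f y :> 0" by blast
    have "f' y = 0" using DERIV_unique[OF deriv y(3)] .
    have mins: "Min (insert z A) = Min A" "Max (insert z A) = z"
      using Min_le[OF insert.hyps(1) M(1)] M(2)
      unfolding Min_insert[OF insert.hyps(1) False] Max_insert[OF insert.hyps(1) False] by linarith+
    have "y \<notin> C" using C(3) y(1) by auto
    moreover have "y \<notin> A" using Max_ge[OF insert.hyps(1), of y] y(1) by auto
    moreover have "z \<notin> C" using C(3) M(2) by auto
    moreover have "z \<notin> A" using insert.hyps(2) by blast
    moreover have "insert y C \<subseteq> {Min A..z}"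
      using C(3) y M(2) Min_le[OF insert.hyps(1) M(1)] by fastforce
    ultimately show ?thesis
      using C(1,2,4,5) \<open>f' y = 0\<close> y(2) insert.hyps(1)
      unfolding mins by (intro exI[of _ "insert y C"] conjI) auto
  qed
qed

text \<open>B collects double zeros. Rolle gives |A| - 1 zeros of the first derivative outside A,
  hence |A| + |B| - 1 together with B. A second application leaves at least 2 k + 1 zeros of the
  second derivative, a trigonometric polynomial with constant term 2 \<beta>.\<close>

lemma quad_trig_zeros:
  assumes fin: "finite A" and BA: "B \<subseteq> A"
    and card: "card A + card B \<ge> 2 * k + 3"
    and A: "A \<subseteq> {lo..hi}" and len: "hi - lo < 2 * pi"
    and zero: "\<And>t. t \<in> A \<Longrightarrow> quad_trig k c \<alpha> \<beta> a b t = 0"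
    and zero': "\<And>t. t \<in> B \<Longrightarrow> quad_trig k \<alpha> (2 * \<beta>) 0 (\<lambda>l. real (Suc l) * b l) (\<lambda>l. - real (Suc l) * a l) t = 0"
  shows "\<beta> = 0"
proof -
  have "A \<noteq> {}" using card BA by auto
  obtain C where C: "finite C" "C \<inter> A = {}" "C \<subseteq> {Min A..Max A}" "Suc (card C) = card A"
    "\<forall>t\<in>C. quad_trig k \<alpha> (2 * \<beta>) 0 (\<lambda>l. real (Suc l) * b l) (\<lambda>l. - real (Suc l) * a l) t = 0"
    using Rolle_zeros[OF has_real_derivative_quad_trig fin \<open>A \<noteq> {}\<close> zero] by blast
  have finB: "finite B" using BA fin finite_subset by blast
  have cBC: "card (B \<union> C) = card B + card C"
    using finB C(1,2) BA by (intro card_Un_disjoint) auto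
  have neBC: "B \<union> C \<noteq> {}"
  proof
    assume "B \<union> C = {}"
    then have "card B + card C = 0" using cBC by simp
    then show False using card C(4) by simp
  qed
  have "\<exists>D. finite D \<and> D \<inter> (B \<union> C) = {} \<and> D \<subseteq> {Min (B \<union> C)..Max (B \<union> C)} \<and> Suc (card D) = card (B \<union> C) \<and>
    (\<forall>t\<in>D. quad_trig k (2 * \<beta>) (2 * 0) 0 (\<lambda>l. real (Suc l) * (- real (Suc l) * a l)) (\<lambda>l. - real (Suc l) * (real (Suc l) * b l)) t = 0)"
  proof (rule Rolle_zeros)
    show "quad_trig k \<alpha> (2 * \<beta>) 0 (\<lambda>l. real (Suc l) * b l) (\<lambda>l. - real (Suc l) * a l) t = 0"
      if "t \<in> B \<union> C" for t
      using that C(5) zero' by blast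
  qed (use finB C(1) neBC has_real_derivative_quad_trig in blast)+
  then obtain D where D: "finite D" "D \<subseteq> {Min (B \<union> C)..Max (B \<union> C)}" "Suc (card D) = card (B \<union> C)"
    "\<forall>t\<in>D. quad_trig k (2 * \<beta>) (2 * 0) 0 (\<lambda>l. real (Suc l) * (- real (Suc l) * a l)) (\<lambda>l. - real (Suc l) * (real (Suc l) * b l)) t = 0"
    by blast
  have "Min A \<in> A" "Max A \<in> A" using fin \<open>A \<noteq> {}\<close> by auto
  then have "B \<union> C \<subseteq> {lo..hi}" using BA A C(3) by fastforce
  moreover have "Min (B \<union> C) \<in> B \<union> C" "Max (B \<union> C) \<in> B \<union> C"
    using finB C(1) \<open>B \<union> C \<noteq> {}\<close> Min_in Max_in by (metis finite_UnI)+
  ultimately have Dsub: "D \<subseteq> {lo..hi}" using D(2) by (smt (verit) atLeastAtMost_iff subset_iff)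
  have "2 * \<beta> = 0 \<and> (\<forall>l<k. real (Suc l) * (- real (Suc l) * a l) = 0 \<and> - real (Suc l) * (real (Suc l) * b l) = 0)"
  proof (rule trig_polynomial_eq_0)
    show "2 * k + 1 \<le> card D" using D(3) cBC C(4) card by simp
    show "\<bar>s - t\<bar> < 2 * pi" if "s \<in> D" "t \<in> D" for s t
    proof -
      have "s \<in> {lo..hi}" "t \<in> {lo..hi}" using Dsub that by blast+
      then show ?thesis using len by auto
    qed
  qed (use D(4) in auto)
  then show ?thesis by simp
qed

text \<open>Uniqueness for Hermite interpolation. Without a quadratic term one derivative suffices:
  the k + 1 nodes and the k Rolle points between them are 2 k + 1 zeros of a trigonometric
  polynomial. The constant c, lost by differentiation, comes back from any zero of the function
  itself.\<close>

lemma quad_trig_double_zeros_eq_0: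
  assumes "finite A" and card: "card A = Suc k"
    and A: "A \<subseteq> {lo..hi}" and len: "hi - lo < 2 * pi"
    and zero: "\<And>t. t \<in> A \<Longrightarrow> quad_trig k c \<alpha> 0 a b t = 0"
    and zero': "\<And>t. t \<in> A \<Longrightarrow> quad_trig k \<alpha> 0 0 (\<lambda>l. real (Suc l) * b l) (\<lambda>l. - real (Suc l) * a l) t = 0"
  shows "c = 0 \<and> \<alpha> = 0 \<and> (\<forall>l<k. a l = 0 \<and> b l = 0)"
proof -
  have "A \<noteq> {}" using card by auto
  obtain C where C: "finite C" "C \<inter> A = {}" "C \<subseteq> {Min A..Max A}" "Suc (card C) = card A"
    "\<forall>t\<in>C. quad_trig k \<alpha> (2 * 0) 0 (\<lambda>l. real (Suc l) * b l) (\<lambda>l. - real (Suc l) * a l) t = 0"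
    using Rolle_zeros[OF has_real_derivative_quad_trig \<open>finite A\<close> \<open>A \<noteq> {}\<close> zero] by blast
  have sub: "A \<union> C \<subseteq> {lo..hi}"
    using Min_in[OF \<open>finite A\<close> \<open>A \<noteq> {}\<close>] Max_in[OF \<open>finite A\<close> \<open>A \<noteq> {}\<close>] A C(3) by fastforce
  have *: "\<alpha> = 0 \<and> (\<forall>l<k. real (Suc l) * b l = 0 \<and> - real (Suc l) * a l = 0)"
  proof (rule trig_polynomial_eq_0)
    show "2 * k + 1 \<le> card (A \<union> C)"
      using C \<open>finite A\<close> card by (subst card_Un_disjoint) auto
    show "\<bar>s - t\<bar> < 2 * pi" if "s \<in> A \<union> C" "t \<in> A \<union> C" for s t
    proof -
      have "s \<in> {lo..hi}" "t \<in> {lo..hi}" using sub that by blast+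
      then show ?thesis using len by auto
    qed
  qed (use C(5) zero' in auto)
  then have "\<forall>l<k. a l = 0 \<and> b l = 0" by simp
  moreover obtain t where "t \<in> A" using \<open>A \<noteq> {}\<close> by blast
  ultimately show ?thesis using * zero[of t] by (simp add: quad_trig_def)
qed

section \<open>Sign of a function with k + 1 double zeros\<close>

lemma sum_cis_equispaced:
  assumes "l < k"
  shows "(\<Sum>m\<le>k. cis (real (Suc l) * (s + 2 * pi * real m / real (Suc k)))) = 0"
proof -
  \<comment> \<open>A root of unity of order dividing k + 1, nontrivial because 0 < l + 1 < k + 1;
    so the geometric sum of its powers vanishes.\<close>
  define z where "z = cis (2 * pi * real (Suc l) / real (Suc k))"
  have "z \<noteq> 1"
  proof
    assume "z = 1"
    then have "2 * pi * real (Suc l) / real (Suc k) = 0"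
      unfolding z_def by (intro cis_eq_imp_eq) (use assms in \<open>auto simp: abs_mult divide_simps\<close>)
    then show False by simp
  qed
  have "z ^ Suc k = cis (2 * pi * real (Suc l))"
    unfolding z_def Complex.DeMoivre by (simp del: of_nat_Suc)
  also have "\<dots> = 1" by (rule cis_multiple_2pi) (simp flip: of_nat_Suc)
  finally have "(\<Sum>m\<le>k. z ^ m) = 0"
    using sum_gp_basic[of z k] \<open>z \<noteq> 1\<close> by simp
  moreover have "cis (real (Suc l) * (s + 2 * pi * real m / real (Suc k))) = cis (real (Suc l) * s) * z ^ m" for m
    unfolding z_def Complex.DeMoivre cis_mult by (simp add: field_simps)
  ultimately show ?thesis
    by (simp only: sum_distrib_left[symmetric] mult_zero_right)
qed

text \<open>The frequencies 1, ..., k average out over k + 1 equally spaced points of a period. For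
  a second derivative with constant term 2, this yields a point where it is positive.\<close>

lemma sum_quad_trig_equispaced:
  "(\<Sum>m\<le>k. quad_trig k c 0 0 a b (s + 2 * pi * real m / real (Suc k))) = real (Suc k) * c"
proof -
  let ?u = "\<lambda>m. s + 2 * pi * real m / real (Suc k)"
  have cs: "(\<Sum>m\<le>k. cos (real (Suc l) * ?u m)) = 0" "(\<Sum>m\<le>k. sin (real (Suc l) * ?u m)) = 0" if "l < k" for l
    using arg_cong[OF sum_cis_equispaced[OF that, of s], of Re] arg_cong[OF sum_cis_equispaced[OF that, of s], of Im]
    by (simp_all only: Re_sum Im_sum cis.simps zero_complex.simps)
  have "(\<Sum>m\<le>k. \<Sum>l<k. a l * cos (real (Suc l) * ?u m) + b l * sin (real (Suc l) * ?u m))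
      = (\<Sum>l<k. a l * (\<Sum>m\<le>k. cos (real (Suc l) * ?u m)) + b l * (\<Sum>m\<le>k. sin (real (Suc l) * ?u m)))"
    by (subst sum.swap) (simp only: sum.distrib sum_distrib_left)
  also have "\<dots> = 0"
    using cs by (intro sum.neutral) simp
  finally show ?thesis
    unfolding quad_trig_def by (simp add: sum.distrib)
qed

lemma strict_local_min:
  fixes f f' :: "real \<Rightarrow> real"
  assumes "\<And>t. (f has_real_derivative f' t) (at t)"
    and "(f' has_real_derivative d) (at z)" "d > 0" "f' z = 0"
  shows "\<exists>e>0. \<forall>t. t \<noteq> z \<and> \<bar>t - z\<bar> < e \<longrightarrow> f z < f t"
proof -
  obtain e1 where e1: "e1 > 0" "\<And>h. 0 < h \<Longrightarrow> h < e1 \<Longrightarrow> f' z < f' (z + h)"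
    using DERIV_pos_inc_right[OF assms(2,3)] by blast
  obtain e2 where e2: "e2 > 0" "\<And>h. 0 < h \<Longrightarrow> h < e2 \<Longrightarrow> f' (z - h) < f' z"
    using DERIV_pos_inc_left[OF assms(2,3)] by blast
  have "f z < f t" if "t \<noteq> z" "\<bar>t - z\<bar> < min e1 e2" for t
  proof (cases "z < t")
    case True
    then obtain x where x: "z < x" "x < t" "f t - f z = (t - z) * f' x"
      using MVT2[of z t f f'] assms(1) by blast
    have "f' x > 0" using e1(2)[of "x - z"] x that assms(4) by auto
    then show ?thesis using x True by (smt (verit) mult_pos_pos)
  next
    case False
    then have "t < z" using that by simp
    then obtain x where x: "t < x" "x < z" "f z - f t = (z - t) * f' x"
      using MVT2[of t z f f'] assms(1) by blast
    have "f' x < 0" using e2(2)[of "z - x"] x that assms(4) by auto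
    then show ?thesis using x \<open>t < z\<close> by (smt (verit) mult_pos_neg)
  qed
  then show ?thesis
    using e1(1) e2(1) by (intro exI[of _ "min e1 e2"]) auto
qed

text \<open>The sign of \<open>F\<close> beyond its last zero is that of \<open>F''\<close>, which is constant outside the zeros of
  \<open>F''\<close> and hence at \<open>k + 1\<close> equally spaced points of a period, where \<open>F''\<close> has mean value \<open>2\<close>.\<close>

lemma quad_trig_pos_off_double_zeros:
  assumes "finite S" and card: "card S = Suc k"
    and S: "S \<subseteq> {lo..hi}" and len: "hi - lo < 2 * pi / real (Suc k)"
    and zero: "\<And>t. t \<in> S \<Longrightarrow> quad_trig k c \<alpha> 1 a b t = 0"
    and zero': "\<And>t. t \<in> S \<Longrightarrow> quad_trig k \<alpha> 2 0 (\<lambda>l. real (Suc l) * b l) (\<lambda>l. - real (Suc l) * a l) t = 0"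
    and s: "s \<in> {lo..hi} - S"
  shows "quad_trig k c \<alpha> 1 a b s > 0"
proof -
  define f f' f'' where "f = quad_trig k c \<alpha> 1 a b"
    and "f' = quad_trig k \<alpha> 2 0 (\<lambda>l. real (Suc l) * b l) (\<lambda>l. - real (Suc l) * a l)"
    and "f'' = quad_trig k 2 0 0 (\<lambda>l. real (Suc l) * (- real (Suc l) * a l)) (\<lambda>l. - real (Suc l) * (real (Suc l) * b l))"
  have der: "(f has_real_derivative f' t) (at t)" for t
    using has_real_derivative_quad_trig[of k c \<alpha> 1 a b t] by (simp only: f_def f'_def mult_1_right)
  have der': "(f' has_real_derivative f'' t) (at t)" for t
    using has_real_derivative_quad_trig[of k \<alpha> 2 0 "\<lambda>l. real (Suc l) * b l" "\<lambda>l. - real (Suc l) * a l" t]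
    by (simp only: f'_def f''_def mult_zero_right)
  have contf: "continuous_on X f" for X
    using der by (intro DERIV_continuous_on) (rule has_field_derivative_at_within)
  have contf'': "continuous_on X f''" for X
    unfolding f''_def
    by (intro DERIV_continuous_on, rule has_field_derivative_at_within, rule has_real_derivative_quad_trig)
  have len2: "hi - lo < 2 * pi"
  proof -
    have "2 * pi / real (Suc k) \<le> 2 * pi / 1"
      by (intro divide_left_mono) auto
    then show ?thesis using len by simp
  qed
  have "S \<noteq> {}" using card by auto
  define M where "M = Max S"
  define m where "m = Min S"
  have mM: "m \<in> S" "M \<in> S" "\<And>t. t \<in> S \<Longrightarrow> m \<le> t \<and> t \<le> M"
    unfolding m_def M_def using \<open>finite S\<close> \<open>S \<noteq> {}\<close> by auto
  have bnd: "lo \<le> m" "m \<le> M" "M \<le> hi"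
    using mM S by auto
  obtain C where C: "finite C" "C \<inter> S = {}" "C \<subseteq> {m..M}" "Suc (card C) = card S" "\<forall>t\<in>C. f' t = 0"
    using Rolle_zeros[OF der \<open>finite S\<close> \<open>S \<noteq> {}\<close>] zero unfolding f_def m_def M_def by blast
  have z': "f' t = 0" if "t \<in> S \<union> C" for t
    using that C(5) zero' unfolding f'_def by blast
  obtain D where D: "finite D" "D \<inter> (S \<union> C) = {}" "D \<subseteq> {Min (S \<union> C)..Max (S \<union> C)}"
    "Suc (card D) = card (S \<union> C)" "\<forall>t\<in>D. f'' t = 0"
    using Rolle_zeros[OF der' _ _ z', of "S \<union> C"] \<open>finite S\<close> C(1) \<open>S \<noteq> {}\<close> by blast
  have "Min (S \<union> C) = m" "Max (S \<union> C) = M"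
    using C(1,3) mM \<open>finite S\<close> by (auto intro!: Min_eqI Max_eqI)
  then have "D \<subseteq> {m..M}" using D(3) by simp
  moreover have "m \<notin> D" "M \<notin> D" using D(2) mM(1,2) by blast+
  ultimately have Dm: "D \<subseteq> {m<..<M}"
    by (force simp: less_le)
  \<comment> \<open>The k + 1 points of S and the k points of C are zeros of \<open>f'\<close>, so
    Rolle leaves 2 k zeros of \<open>f''\<close>. Since \<open>f''\<close> has constant term 2, it
    is not identically zero, and D exhausts its zeros in the period starting at m.\<close>
  have cardD: "card D = 2 * k"
    using D(4) C \<open>finite S\<close> card by (subst (asm) card_Un_disjoint) auto
  have f''_nz: "f'' t \<noteq> 0" if t: "t \<notin> D" "m \<le> t" "t < m + 2 * pi" for t
  proof
    assume "f'' t = 0"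
    have "(2::real) = 0 \<and> (\<forall>l<k. real (Suc l) * (- real (Suc l) * a l) = 0 \<and> - real (Suc l) * (real (Suc l) * b l) = 0)"
    proof (rule trig_polynomial_eq_0)
      show "2 * k + 1 \<le> card (insert t D)"
        using t(1) D(1) cardD by simp
      have sub: "insert t D \<subseteq> {m..<m + 2 * pi}"
        using Dm t bnd len2 by auto
      show "\<bar>x - y\<bar> < 2 * pi" if "x \<in> insert t D" "y \<in> insert t D" for x y
      proof -
        have "x \<in> {m..<m + 2 * pi}" "y \<in> {m..<m + 2 * pi}" using that sub by blast+
        then show ?thesis by auto
      qed
    qed (use D(5) \<open>f'' t = 0\<close> in \<open>auto simp: f''_def\<close>)
    then show False by simp
  qed
  have Mm: "M - m < 2 * pi / real (Suc k)"
    using bnd len by linarith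
  have f''_pos: "f'' t > 0" if t: "M \<le> t" "t < m + 2 * pi" for t
  proof (rule ccontr)
    assume "\<not> f'' t > 0"
    define u where "u j = M + 2 * pi * real j / real (Suc k)" for j
    have "\<exists>j\<le>k. f'' (u j) > 0"
    proof (rule ccontr)
      assume "\<not> ?thesis"
      then have "(\<Sum>j\<le>k. f'' (u j)) \<le> 0"
        by (intro sum_nonpos) (auto simp: not_less)
      then show False
        unfolding f''_def u_def sum_quad_trig_equispaced by simp
    qed
    then obtain j where j: "j \<le> k" "f'' (u j) > 0" by blast
    have "u j \<le> M + 2 * pi * real k / real (Suc k)"
      unfolding u_def using j(1) by (simp add: divide_right_mono)
    also have "\<dots> = M + 2 * pi - 2 * pi / real (Suc k)"
      by (simp add: field_simps)
    finally have uj: "M \<le> u j" "u j < m + 2 * pi"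
      using Mm by (simp_all add: u_def)
    have "\<exists>x. min t (u j) \<le> x \<and> x \<le> max t (u j) \<and> f'' x = 0"
    proof (cases "t \<le> u j")
      case True
      then show ?thesis
        using IVT'[of f'' t 0 "u j"] \<open>\<not> f'' t > 0\<close> j(2) contf'' by auto
    next
      case False
      then show ?thesis
        using IVT2'[of f'' t 0 "u j"] \<open>\<not> f'' t > 0\<close> j(2) contf'' by auto
    qed
    then obtain x where x: "min t (u j) \<le> x" "x \<le> max t (u j)" "f'' x = 0" by blast
    have "M \<le> x" "x < m + 2 * pi"
      using x t uj by linarith+
    then show False
      using f''_nz[of x] x(3) Dm bnd by fastforce
  qed
  have hi: "hi < m + 2 * pi" using len2 bnd by linarith
  \<comment> \<open>Since f and \<open>f'\<close> vanish at M, the mean value theorem passes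
    positivity from \<open>f''\<close> to \<open>f'\<close> and then to f.\<close>
  have right: "f t > 0" if t: "M < t" "t \<le> hi" for t
  proof -
    have f'_pos: "f' x > 0" if x: "M < x" "x \<le> hi" for x
    proof -
      obtain y where y: "M < y" "y < x" "f' x - f' M = (x - M) * f'' y"
        using MVT2[of M x f' f''] x der' by blast
      have "f'' y > 0" using f''_pos[of y] y x hi by simp
      then show ?thesis using y z'[of M] mM(2) x by simp
    qed
    obtain y where y: "M < y" "y < t" "f t - f M = (t - M) * f' y"
      using MVT2[of M t f f'] t der by blast
    then have "f' y > 0" using f'_pos t by simp
    then show ?thesis using y zero[of M] mM(2) t by (simp add: f_def)
  qed
  \<comment> \<open>A further zero would raise the count with multiplicity to (k + 2) + (k + 1) = 2
    k + 3.\<close>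
  have nz: "f t \<noteq> 0" if t: "t \<in> {lo..hi} - S" for t
  proof
    assume "f t = 0"
    have "(1::real) = 0"
    proof (rule quad_trig_zeros)
      show "2 * k + 3 \<le> card (insert t S) + card S"
        using \<open>finite S\<close> card t by simp
      show "insert t S \<subseteq> {lo..hi}" using t S by blast
      show "quad_trig k c \<alpha> 1 a b x = 0" if "x \<in> insert t S" for x
        using that zero \<open>f t = 0\<close> by (auto simp: f_def)
      show "quad_trig k \<alpha> (2 * 1) 0 (\<lambda>l. real (Suc l) * b l) (\<lambda>l. - real (Suc l) * a l) x = 0" if "x \<in> S" for x
        using that zero' by simp
    qed (use \<open>finite S\<close> len2 in auto)
    then show False by simp
  qed
  have "\<not> f s < 0"
  proof
    assume neg: "f s < 0"
    then have "s < M" using right[of s] s zero[of s] mM(2) by (force simp: not_less less_le)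
    \<comment> \<open>At the last sign change z the function vanishes, so z lies in S, with
      \<open>f' z = 0\<close> and \<open>f'' z \<noteq> 0\<close>. A strict local minimum
      contradicts the negative values accumulating at z from the left, a strict local maximum the
      nonnegative values to its right.\<close>
    define U where "U = {t. s \<le> t \<and> t \<le> M \<and> f t < 0}"
    define z where "z = Sup U"
    have "s \<in> U" using neg \<open>s < M\<close> by (simp add: U_def)
    have bdd: "bdd_above U" by (auto simp: U_def bdd_above_def)
    have z: "s \<le> z" "z \<le> M"
      using \<open>s \<in> U\<close> bdd unfolding z_def by (auto simp: U_def intro: cSup_upper cSup_least)
    have above: "f t \<ge> 0" if "z < t" "t \<le> M" for t
      using that z cSup_upper[OF _ bdd, of t] by (force simp: U_def z_def)
    have close: "\<exists>t\<in>U. z - e < t \<and> t \<le> z" if "e > 0" for e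
    proof -
      have "\<exists>x\<in>U. z - e < x" 
        using less_cSup_iff[of U "z - e"] \<open>s \<in> U\<close> bdd that unfolding z_def by force
      then show ?thesis using cSup_upper[OF _ bdd] unfolding z_def by blast
    qed
    have isC: "isCont f z" using der DERIV_isCont by blast
    have cont_pos: "\<exists>d>0. \<forall>x. \<bar>z - x\<bar> < d \<longrightarrow> g x > 0" if g: "isCont g z" "g z > 0" for g :: "real \<Rightarrow> real"
    proof -
      obtain d where d: "d > 0" "\<And>x. dist x z < d \<Longrightarrow> dist (g x) (g z) < g z"
        using g unfolding continuous_at_eps_delta by blast
      have "g x > 0" if "\<bar>z - x\<bar> < d" for x
        using d(2)[of x] that unfolding dist_real_def by linarith
      then show ?thesis using d(1) by blast
    qed
    have "f z = 0"
    proof (rule ccontr)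
      assume "f z \<noteq> 0"
      then consider "f z > 0" | "f z < 0" by linarith
      then show False
      proof cases
        case 1
        then obtain d where d: "d > 0" "\<And>x. \<bar>z - x\<bar> < d \<Longrightarrow> f x > 0"
          using cont_pos[OF isC] by blast
        obtain t where "t \<in> U" "z - d < t" "t \<le> z" using close[OF d(1)] by blast
        then show False using d(2)[of t] by (simp add: U_def)
      next
        case 2
        then obtain d where d: "d > 0" "\<And>x. \<bar>z - x\<bar> < d \<Longrightarrow> f x < 0"
          using cont_pos[of "\<lambda>x. - f x"] isC by auto
        have "z \<noteq> M" using 2 zero[of M] mM(2) by (auto simp: f_def)
        then have "f (min M (z + d / 2)) \<ge> 0" using above d(1) z by auto
        moreover have "\<bar>z - min M (z + d / 2)\<bar> < d" using d(1) z by (auto simp: min_def)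
        ultimately show False using d(2)[of "min M (z + d / 2)"] by linarith
      qed
    qed
    moreover have "lo \<le> z" "z \<le> hi" using z s bnd by auto
    ultimately have "z \<in> S" using nz by auto
    then have "f' z = 0" "f'' z \<noteq> 0"
      using z'[of z] f''_nz[of z] D(2) mM(3)[of z] hi bnd by auto
    then consider "f'' z > 0" | "f'' z < 0" by linarith
    then show False
    proof cases
      case 1
      obtain e where e: "e > 0" "\<forall>t. t \<noteq> z \<and> \<bar>t - z\<bar> < e \<longrightarrow> f z < f t"
        using strict_local_min[OF der der' 1 \<open>f' z = 0\<close>] by blast
      obtain t where "t \<in> U" "z - e < t" "t \<le> z" using close[OF e(1)] by blast
      then show False using e(2)[rule_format, of t] \<open>f z = 0\<close> by (cases "t = z") (auto simp: U_def)
    next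
      case 2
      have "((\<lambda>t. - f t) has_real_derivative - f' t) (at t)" for t
        using DERIV_minus[OF der] .
      then obtain e where e: "e > 0" "\<forall>t. t \<noteq> z \<and> \<bar>t - z\<bar> < e \<longrightarrow> - f z < - f t"
        using strict_local_min[of "\<lambda>t. - f t" "\<lambda>t. - f' t" "- f'' z" z] DERIV_minus[OF der'[of z]] 2 \<open>f' z = 0\<close>
        by auto
      have "M < m + 2 * pi" using hi bnd by linarith
      then have "z \<noteq> M" using 2 f''_pos[of M] by auto
      then have "f (min M (z + e / 2)) \<ge> 0" using above e(1) z by auto
      moreover have "min M (z + e / 2) \<noteq> z" "\<bar>min M (z + e / 2) - z\<bar> < e"
        using \<open>z \<noteq> M\<close> z e(1) by (auto simp: min_def)
      ultimately show False using e(2)[rule_format, of "min M (z + e / 2)"] \<open>f z = 0\<close> by linarith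
    qed
  qed
  then show ?thesis using nz[OF s] by (simp add: f_def)
qed

section \<open>Zeros forced by nonnegative neighbours\<close>

lemma zero_or_double_zero:
  fixes f :: "real \<Rightarrow> real"
  assumes der: "\<And>t. (f has_real_derivative f' t) (at t)"
    and "\<epsilon> > 0" "f t = 0" "f (t - \<epsilon>) \<ge> 0" "f (t + \<epsilon>) \<ge> 0"
  shows "f' t = 0 \<or> (\<exists>q. q \<noteq> t \<and> \<bar>q - t\<bar> \<le> \<epsilon> \<and> f q = 0)"
proof (rule disjCI, rule ccontr)
  assume no: "\<not> (\<exists>q. q \<noteq> t \<and> \<bar>q - t\<bar> \<le> \<epsilon> \<and> f q = 0)" and "f' t \<noteq> 0"
  have cont: "continuous_on X f" for X
    using der by (intro DERIV_continuous_on) (rule has_field_derivative_at_within)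
  from \<open>f' t \<noteq> 0\<close> consider "f' t > 0" | "f' t < 0" by linarith
  then show False
  proof cases
    case 1
    obtain d where d: "d > 0" "\<And>h. 0 < h \<Longrightarrow> h < d \<Longrightarrow> f (t - h) < f t"
      using DERIV_pos_inc_left[OF der 1] by blast
    \<comment> \<open>With positive slope, f is negative just left of t but nonnegative at t -
      \<epsilon>, so it has another zero on that side. The minimum keeps the negative point inside
      the window. The second case is the mirror image.\<close>
    define h where "h = min (d / 2) \<epsilon>"
    have h: "0 < h" "h < d" "h \<le> \<epsilon>" using d(1) \<open>\<epsilon> > 0\<close> by (auto simp: h_def)
    have "f (t - h) < 0" using d(2) h \<open>f t = 0\<close> by simp
    then obtain q where "t - \<epsilon> \<le> q" "q \<le> t - h" "f q = 0"
      using IVT2'[of f "t - h" 0 "t - \<epsilon>"] h assms(4) cont by fastforce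
    then show False using h no[unfolded not_ex, rule_format, of q] by auto
  next
    case 2
    obtain d where d: "d > 0" "\<And>h. 0 < h \<Longrightarrow> h < d \<Longrightarrow> f (t + h) < f t"
      using DERIV_neg_dec_right[OF der 2] by blast
    define h where "h = min (d / 2) \<epsilon>"
    have h: "0 < h" "h < d" "h \<le> \<epsilon>" using d(1) \<open>\<epsilon> > 0\<close> by (auto simp: h_def)
    have "f (t + h) < 0" using d(2) h \<open>f t = 0\<close> by simp
    then obtain q where "t + h \<le> q" "q \<le> t + \<epsilon>" "f q = 0"
      using IVT'[of f "t + h" 0 "t + \<epsilon>"] h assms(5) cont by fastforce
    then show False using h no[unfolded not_ex, rule_format, of q] by auto
  qed
qed

text \<open>Each point of T accounts for two zeros: it is a double zero or has a companion within
  \<epsilon>. Separation by more than 2 \<epsilon> keeps the companions distinct from each other and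
  from T. This makes 2 k + 4 zeros, while the quadratic coefficient 1 permits at most 2 k +
  2.\<close>

lemma quad_trig_not_nonneg:
  assumes "finite T" and card: "card T = k + 2" and "\<epsilon> > 0"
    and sep: "\<And>s t. s \<in> T \<Longrightarrow> t \<in> T \<Longrightarrow> s \<noteq> t \<Longrightarrow> 2 * \<epsilon> < \<bar>s - t\<bar>"
    and T: "\<And>t. t \<in> T \<Longrightarrow> lo \<le> t - \<epsilon> \<and> t + \<epsilon> \<le> hi" and len: "hi - lo < 2 * pi"
    and zero: "\<And>t. t \<in> T \<Longrightarrow> quad_trig k c \<alpha> 1 a b t = 0"
    and nonneg: "\<And>t. t \<in> T \<Longrightarrow> quad_trig k c \<alpha> 1 a b (t - \<epsilon>) \<ge> 0"
      "\<And>t. t \<in> T \<Longrightarrow> quad_trig k c \<alpha> 1 a b (t + \<epsilon>) \<ge> 0"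
  shows False
proof -
  define f' where "f' = quad_trig k \<alpha> (2 * 1) 0 (\<lambda>l. real (Suc l) * b l) (\<lambda>l. - real (Suc l) * a l)"
  define B where "B = {t \<in> T. f' t = 0}"
  have "\<exists>q. q \<noteq> t \<and> \<bar>q - t\<bar> \<le> \<epsilon> \<and> quad_trig k c \<alpha> 1 a b q = 0" if "t \<in> T - B" for t
    using zero_or_double_zero[OF has_real_derivative_quad_trig \<open>\<epsilon> > 0\<close> zero nonneg, of t] that
    by (auto simp: B_def f'_def)
  then obtain q where q: "\<And>t. t \<in> T - B \<Longrightarrow> q t \<noteq> t \<and> \<bar>q t - t\<bar> \<le> \<epsilon> \<and> quad_trig k c \<alpha> 1 a b (q t) = 0"
    by metis
  have inj: "inj_on q (T - B)"
  proof (rule inj_onI, rule ccontr)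
    fix s t assume *: "s \<in> T - B" "t \<in> T - B" "q s = q t" "s \<noteq> t"
    show False using q[OF *(1)] q[OF *(2)] sep[of s t] * by auto
  qed
  have disj: "T \<inter> q ` (T - B) = {}"
  proof -
    have "q t \<notin> T" if t: "t \<in> T - B" for t
      using q[OF t] sep[of "q t" t] t \<open>\<epsilon> > 0\<close> by auto
    then show ?thesis by blast
  qed
  have finB: "finite B" "B \<subseteq> T" using \<open>finite T\<close> by (auto simp: B_def)
  have "(1::real) = 0"
  proof (rule quad_trig_zeros)
    have "card (T \<union> q ` (T - B)) = card T + card (T - B)"
      using disj inj \<open>finite T\<close> by (simp add: card_Un_disjoint card_image)
    then show "2 * k + 3 \<le> card (T \<union> q ` (T - B)) + card B"
      using finB card card_Diff_subset[OF finB] card_mono[OF \<open>finite T\<close> finB(2)] by simp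
    show "T \<union> q ` (T - B) \<subseteq> {lo..hi}"
    proof
      fix x assume "x \<in> T \<union> q ` (T - B)"
      then obtain t where "t \<in> T" "\<bar>x - t\<bar> \<le> \<epsilon>" using q \<open>\<epsilon> > 0\<close> by fastforce
      then show "x \<in> {lo..hi}" using T[of t] by auto
    qed
    show "quad_trig k c \<alpha> 1 a b x = 0" if "x \<in> T \<union> q ` (T - B)" for x
      using that zero q by blast
    show "quad_trig k \<alpha> (2 * 1) 0 (\<lambda>l. real (Suc l) * b l) (\<lambda>l. - real (Suc l) * a l) x = 0" if "x \<in> B" for x
      using that by (simp only: B_def f'_def mem_Collect_eq)
  qed (use \<open>finite T\<close> finB len in auto)
  then show False by simp
qed

section \<open>Isometries and symmetrization\<close>

text \<open>Using the values of the functionals as coordinates gives an injective endomorphism,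
  which is surjective in finite dimension.\<close>

lemma functional_interpolation:
  fixes \<psi> :: "'i \<Rightarrow> 'b::euclidean_space \<Rightarrow> real"
  assumes "finite I" "card I = DIM('b)"
    and lin: "\<And>i. i \<in> I \<Longrightarrow> linear (\<psi> i)"
    and inj: "\<And>v. (\<And>i. i \<in> I \<Longrightarrow> \<psi> i v = 0) \<Longrightarrow> v = 0"
  shows "\<exists>v. \<forall>i\<in>I. \<psi> i v = y i"
proof -
  obtain h where h: "bij_betw h (Basis :: 'b set) I"
    using finite_same_card_bij[of "Basis :: 'b set" I] assms(1,2) by auto
  define \<Phi> where "\<Phi> v = (\<Sum>b\<in>Basis. \<psi> (h b) v *\<^sub>R b)" for v :: 'b
  have hI: "h b \<in> I" if "b \<in> Basis" for b
    using that h bij_betwE by blast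
  have \<Phi>_inner: "\<Phi> v \<bullet> b = \<psi> (h b) v" if "b \<in> Basis" for v b
    unfolding \<Phi>_def using that by simp
  have "linear \<Phi>"
    unfolding \<Phi>_def
    by (rule linearI)
      (simp_all add: linear_add[OF lin[OF hI]] linear_scale[OF lin[OF hI]] scaleR_add_left sum.distrib scaleR_sum_right)
  moreover have "inj \<Phi>"
  proof -
    have "v = 0" if "\<Phi> v = 0" for v
    proof (rule inj)
      fix i assume "i \<in> I"
      then obtain b where "b \<in> Basis" "i = h b"
        using h by (auto simp: bij_betw_def)
      then show "\<psi> i v = 0" using \<Phi>_inner[of b v] that by simp
    qed
    then show ?thesis
      using linear_injective_0[OF \<open>linear \<Phi>\<close>] by blast
  qed
  ultimately have "surj \<Phi>"
    using linear_injective_imp_surjective by blast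
  then obtain v where v: "\<Phi> v = (\<Sum>b\<in>Basis. y (h b) *\<^sub>R b)"
    by (metis surjD)
  have "\<psi> i v = y i" if "i \<in> I" for i
  proof -
    have "i \<in> h ` Basis" using h that by (simp add: bij_betw_def)
    then obtain b where "b \<in> Basis" "i = h b" by blast
    then show ?thesis using \<Phi>_inner[of b v] v by simp
  qed
  then show ?thesis by blast
qed

section \<open>Transport of polytopes, flats and symmetry along isometries\<close>

lemma isometry_orthogonal_transformation:
  "isometry g \<Longrightarrow> orthogonal_transformation (\<lambda>x. g x - g 0)"
  unfolding orthogonal_transformation_isometry isometry_def by (simp add: dist_norm)

lemma isometry_bij:
  fixes g :: "'a::euclidean_space \<Rightarrow> 'a"
  assumes "isometry g"
  shows "bij g"
proof -
  have "bij ((\<lambda>x. g 0 + x) \<circ> (\<lambda>x. g x - g 0))"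
    by (intro bij_comp orthogonal_transformation_bij isometry_orthogonal_transformation assms bij_plus)
  then show ?thesis by (simp add: comp_def)
qed

lemma isometry_image:
  "g ` S = (+) (g 0) ` (\<lambda>x. g x - g 0) ` S" for g :: "'a::euclidean_space \<Rightarrow> 'a"
  by (simp add: image_image)

lemma convex_polytope_iff_polytope:
  "convex_polytope P \<longleftrightarrow> polytope P \<and> interior P \<noteq> {}"
  by (auto simp: convex_polytope_def polytope_eq_bounded_polyhedron)

lemma polytope_isometry_image:
  fixes g :: "'a::euclidean_space \<Rightarrow> 'a"
  assumes "isometry g" "polytope P"
  shows "polytope (g ` P)"
  unfolding isometry_image[of g P] polytope_translation_eq
  by (intro polytope_linear_image orthogonal_transformation_linear isometry_orthogonal_transformation assms)

lemma convex_polytope_isometry_image: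
  fixes g :: "'a::euclidean_space \<Rightarrow> 'a"
  assumes "isometry g" "convex_polytope P"
  shows "convex_polytope (g ` P)"
proof -
  note L = isometry_orthogonal_transformation[OF assms(1)]
  have "interior (g ` P) = (+) (g 0) ` (\<lambda>x. g x - g 0) ` interior P"
    unfolding isometry_image[of g P] interior_translation
    using interior_bijective_linear_image[OF orthogonal_transformation_linear[OF L] orthogonal_transformation_bij[OF L]]
    by simp
  then show ?thesis
    using assms polytope_isometry_image unfolding convex_polytope_iff_polytope by auto
qed

lemma flat_isometry_image:
  fixes g :: "'a::euclidean_space \<Rightarrow> 'a"
  assumes "isometry g" "flat r f"
  shows "flat r (g ` f)"
proof -
  note L = isometry_orthogonal_transformation[OF assms(1)]
  have "affine ((\<lambda>x. g x - g 0) ` f)"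
    using affine_hull_linear_image[OF linear_linear[THEN iffD2, OF orthogonal_transformation_linear[OF L]], of f] assms(2)
    unfolding flat_def by (metis affine_hull_eq)
  moreover have "aff_dim ((\<lambda>x. g x - g 0) ` f) = aff_dim f"
    using aff_dim_injective_linear_image[OF orthogonal_transformation_linear[OF L]] orthogonal_transformation_inj[OF L]
    by blast
  ultimately show ?thesis
    using assms(2) unfolding flat_def isometry_image[of g f] aff_dim_translation_eq
    by (simp only: affine_translation[symmetric])
qed

text \<open>The conjugate of a reflection by g is the reflection across the image flat: the linear
  part of g preserves inner products, so it carries normal vectors of f to normal vectors of the
  image.\<close>

lemma symmetric_about_isometry_image:
  fixes g :: "'a::euclidean_space \<Rightarrow> 'a"
  assumes g: "isometry g" and "symmetric_about P f"
  shows "symmetric_about (g ` P) (g ` f)"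
proof -
  obtain \<rho> where \<rho>: "reflection_across f \<rho>" "\<rho> ` P = P"
    using assms(2) by (auto simp: symmetric_about_def)
  define L where "L = (\<lambda>x. g x - g 0)"
  have L: "orthogonal_transformation L"
    unfolding L_def by (rule isometry_orthogonal_transformation[OF g])
  have lin: "linear L" using L orthogonal_transformation_linear by blast
  have gL: "g x = g 0 + L x" for x by (simp add: L_def)
  have inv: "g (inv g x) = x" "inv g (g x) = x" for x
    using isometry_bij[OF g] by (auto simp: bij_is_surj bij_is_inj surj_f_inv_f)
  define \<rho>' where "\<rho>' = g \<circ> \<rho> \<circ> inv g"
  have "isometry \<rho>'"
    using g \<rho>(1) inv(1) unfolding isometry_def reflection_across_def \<rho>'_def comp_def by metis
  moreover have "\<rho>' p = p" if "p \<in> g ` f" for p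
    using that \<rho>(1) inv(2) by (auto simp: \<rho>'_def reflection_across_def)
  moreover have "\<rho>' (p + v) = p - v"
    if p: "p \<in> g ` f" and v: "\<forall>x\<in>g ` f. \<forall>y\<in>g ` f. orthogonal v (x - y)" for p v
  proof -
    obtain p' where p': "p' \<in> f" "p = g p'" using p by blast
    obtain w where w: "v = L w" using orthogonal_transformation_surj[OF L] by (metis surjD)
    have "orthogonal w (x - y)" if "x \<in> f" "y \<in> f" for x y
    proof -
      have "orthogonal v (g x - g y)" using v that by blast
      moreover have "g x - g y = L (x - y)" using linear_diff[OF lin] by (simp add: L_def)
      ultimately show ?thesis
        using L by (simp add: w orthogonal_def orthogonal_transformation_def)
    qed
    then have "\<rho> (p' + w) = p' - w"
      using \<rho>(1) p'(1) by (simp add: reflection_across_def)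
    moreover have "p + v = g (p' + w)" "p - v = g (p' - w)"
      using gL[of p'] gL[of "p' + w"] gL[of "p' - w"] linear_add[OF lin, of p' w] linear_diff[OF lin, of p' w]
      by (simp_all add: p' w)
    ultimately show ?thesis by (simp add: \<rho>'_def inv(2))
  qed
  moreover have "\<rho>' ` g ` P = g ` \<rho> ` P"
    by (simp add: \<rho>'_def inv(2) image_image)
  ultimately show ?thesis
    unfolding symmetric_about_def reflection_across_def \<rho>(2) by blast
qed

text \<open>The reflection is across a flat through a point \<open>c\<close> far out in the direction \<open>v\<close>, orthogonal to \<open>c\<close>.
  It maps \<open>0\<close> to \<open>2 c\<close>, hence \<open>ball 0 M\<close> into the interior of \<open>V\<close>.\<close>

lemma symmetrized_polyhedron:
  fixes w :: "'j \<Rightarrow> 'a::euclidean_space" and u :: "'j \<Rightarrow> real"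
  assumes "finite J" and "v \<noteq> 0" and v: "\<And>j. j \<in> J \<Longrightarrow> w j \<bullet> v < 0" and "r < DIM('a)" and "M > 0"
  defines "V \<equiv> {x. \<forall>j\<in>J. w j \<bullet> x \<le> u j}"
  shows "\<exists>P f c. convex_polytope P \<and> P \<subseteq> V \<and> V \<inter> ball 0 M \<subseteq> P \<and> flat r f \<and> symmetric_about P f \<and>
    c \<in> P \<and> (\<forall>j\<in>J. w j \<bullet> c < u j)"
proof -
  \<comment> \<open>Each summand is nonnegative and is the multiple of v that suffices for one j, so
    the sum suffices for all. It puts c strictly inside V, and the ball of radius M about 2 c inside
    V as well.\<close>
  define \<mu> where "\<mu> = (\<Sum>j\<in>J. (\<bar>u j\<bar> + norm (w j) * M + 1) / - (w j \<bullet> v))"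
  define c where "c = \<mu> *\<^sub>R v"
  have \<mu>: "\<mu> * (w j \<bullet> v) + norm (w j) * M < u j" "\<mu> * (w j \<bullet> v) \<le> 0" if j: "j \<in> J" for j
  proof -
    have pos: "(\<bar>u i\<bar> + norm (w i) * M + 1) / - (w i \<bullet> v) \<ge> 0" if "i \<in> J" for i
      using v[OF that] \<open>M > 0\<close> by (intro divide_nonneg_nonneg add_nonneg_nonneg mult_nonneg_nonneg) auto
    have "(\<bar>u j\<bar> + norm (w j) * M + 1) / - (w j \<bullet> v) \<le> \<mu>"
      unfolding \<mu>_def using pos \<open>finite J\<close> j by (intro member_le_sum) auto
    then have "\<bar>u j\<bar> + norm (w j) * M + 1 \<le> \<mu> * - (w j \<bullet> v)"
      using v[OF j] by (subst (asm) pos_divide_le_eq) auto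
    moreover have "norm (w j) * M \<ge> 0" using \<open>M > 0\<close> by simp
    ultimately show "\<mu> * (w j \<bullet> v) + norm (w j) * M < u j" "\<mu> * (w j \<bullet> v) \<le> 0"
      by linarith+
  qed
  have c_strict: "w j \<bullet> c < u j" if "j \<in> J" for j
  proof -
    have "norm (w j) * M \<ge> 0" using \<open>M > 0\<close> by simp
    then have "\<mu> * (w j \<bullet> v) < u j" using \<mu>(1)[OF that] by linarith
    then show ?thesis by (simp add: c_def)
  qed
  have V_far: "x \<in> V" if x: "dist x (2 *\<^sub>R c) < M" for x
    unfolding V_def
  proof (intro CollectI ballI)
    fix j assume j: "j \<in> J"
    have "w j \<bullet> (x - 2 *\<^sub>R c) \<le> norm (w j) * norm (x - 2 *\<^sub>R c)" by (rule norm_cauchy_schwarz)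
    also have "\<dots> \<le> norm (w j) * M" using x by (intro mult_left_mono) (auto simp: dist_norm)
    finally have "w j \<bullet> x \<le> 2 * (\<mu> * (w j \<bullet> v)) + norm (w j) * M"
      by (simp add: inner_diff_right c_def)
    then show "w j \<bullet> x \<le> u j" using \<mu>[OF j] by linarith
  qed
  \<comment> \<open>The directions W of the flat are chosen in the hyperplane orthogonal to v. Then
    c is normal to the flat through c, which gives \<open>\<rho> 0 = 2 *\<^sub>R c\<close>.\<close>
  have "r \<le> dim {x. v \<bullet> x = 0}"
    using assms(4) dim_hyperplane[OF \<open>v \<noteq> 0\<close>] by simp
  then obtain W where W: "subspace W" "W \<subseteq> span {x. v \<bullet> x = 0}" "dim W = r"
    by (rule choose_subspace_of_subspace)
  have "span {x. v \<bullet> x = 0} = {x. v \<bullet> x = 0}"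
    using subspace_hyperplane[of v] by (simp only: span_eq_iff)
  with W(2) have Wc: "orthogonal c x" if "x \<in> W" for x
    using that by (auto simp: c_def orthogonal_def)
  define f where "f = (+) c ` W"
  have flat: "flat r f"
    unfolding flat_def f_def aff_dim_translation_eq
    using W(1,3) by (simp add: affine_translation[symmetric] subspace_imp_affine aff_dim_subspace)
  then obtain \<rho> where \<rho>: "reflection_across f \<rho>" using reflection_across_ex1 by blast
  have orth: "(\<forall>x\<in>f. \<forall>y\<in>f. orthogonal z (x - y)) \<longleftrightarrow> (\<forall>x\<in>W. orthogonal z x)" for z
  proof
    assume *: "\<forall>x\<in>f. \<forall>y\<in>f. orthogonal z (x - y)"
    show "\<forall>x\<in>W. orthogonal z x"
    proof
      fix x assume "x \<in> W"
      then have "orthogonal z (c + x - (c + 0))"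
        using * subspace_0[OF W(1)] unfolding f_def by blast
      then show "orthogonal z x" by simp
    qed
  next
    assume *: "\<forall>x\<in>W. orthogonal z x"
    then show "\<forall>x\<in>f. \<forall>y\<in>f. orthogonal z (x - y)"
      unfolding f_def using subspace_diff[OF W(1)] by auto
  qed
  have "c \<in> f" unfolding f_def using subspace_0[OF W(1)] by force
  have \<rho>_eq: "\<rho> (p + z) = p - z" if "p \<in> f" "\<And>x. x \<in> W \<Longrightarrow> orthogonal z x" for p z
    using \<rho> orth[of z] that unfolding reflection_across_def by blast
  have \<rho>c: "\<rho> c = c" using \<rho> \<open>c \<in> f\<close> unfolding reflection_across_def by blast
  have \<rho>0: "\<rho> 0 = 2 *\<^sub>R c"
    using \<rho>_eq[OF \<open>c \<in> f\<close>, of "- c"] Wc by (simp add: orthogonal_def scaleR_2)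
  have iso: "dist (\<rho> x) (\<rho> y) = dist x y" for x y
    using \<rho> unfolding reflection_across_def isometry_def by blast
  \<comment> \<open>Every point is a point of the flat plus a normal vector, so the prescribed
    values determine \<rho> everywhere. Being an involution, \<rho> swaps Q with its image and
    preserves their intersection.\<close>
  have \<rho>\<rho>: "\<rho> (\<rho> x) = x" for x
  proof -
    obtain y z where yz: "y \<in> span W" "\<And>t. t \<in> span W \<Longrightarrow> orthogonal z t" "x - c = y + z"
      using orthogonal_subspace_decomp_exists[of W "x - c"] by metis
    have "y \<in> W" using yz(1) W(1) by (metis span_eq_iff)
    then have y: "c + y \<in> f" by (simp add: f_def)
    have z: "\<And>t. t \<in> W \<Longrightarrow> orthogonal z t" "\<And>t. t \<in> W \<Longrightarrow> orthogonal (- z) t"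
      using yz(2) span_base by (auto simp: orthogonal_def)
    have x: "x = c + y + z" using yz(3) by (simp add: algebra_simps)
    then show ?thesis
      using \<rho>_eq[OF y z(1)] \<rho>_eq[OF y z(2)] by simp
  qed
  \<comment> \<open>Large enough for the bounding box to contain \<open>ball 0 M\<close>, its
    reflection, which lies around 2 c, and a neighbourhood of c.\<close>
  define R where "R = M + 2 * norm c + 1"
  obtain b where b: "ball 0 R \<subseteq> cbox (- b) (b :: 'a)"
    using bounded_subset_cbox_symmetric[OF bounded_ball] by blast
  define Q where "Q = V \<inter> cbox (- b) b"
  define P where "P = Q \<inter> \<rho> ` Q"
  have V_eq: "V = \<Inter> ((\<lambda>j. {x. w j \<bullet> x \<le> u j}) ` J)"
    unfolding V_def by auto
  have "polytope Q"
    unfolding Q_def V_eq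
    by (intro polyhedron_Int_polytope polytope_interval polyhedron_Inter) (auto simp: \<open>finite J\<close> polyhedron_halfspace_le)
  then have "polytope P"
    unfolding P_def using \<rho> by (intro polytope_Int polytope_isometry_image) (auto simp: reflection_across_def)
  have inP: "x \<in> P" if "x \<in> Q" "\<rho> x \<in> Q" for x
    unfolding P_def using that \<rho>\<rho>[of x] by (metis IntI image_eqI)
  have "\<rho> ` P = P"
  proof -
    have "\<rho> ` P \<subseteq> P"
    proof
      fix x assume "x \<in> \<rho> ` P"
      then obtain y where y: "x = \<rho> y" "y \<in> Q" "y \<in> \<rho> ` Q" by (auto simp: P_def)
      then show "x \<in> P" using inP[of x] \<rho>\<rho> by auto
    qed
    moreover have "P \<subseteq> \<rho> ` P"
      using image_mono[OF calculation, of \<rho>] by (simp add: image_image \<rho>\<rho>)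
    ultimately show ?thesis by blast
  qed
  define O' where "O' = (\<Inter>j\<in>J. {x. w j \<bullet> x < u j}) \<inter> ball 0 R"
  have "open O'"
    unfolding O'_def using \<open>finite J\<close> by (intro open_Int open_INT ballI open_halfspace_lt open_ball) auto
  moreover have "c \<in> O'"
    using c_strict \<open>M > 0\<close> norm_ge_zero[of c] unfolding O'_def R_def by (auto simp del: norm_ge_zero)
  ultimately obtain \<delta> where \<delta>: "\<delta> > 0" "ball c \<delta> \<subseteq> O'"
    by (meson open_contains_ball)
  have "O' \<subseteq> Q"
    using b unfolding O'_def Q_def V_def by (auto simp: less_imp_le)
  \<comment> \<open>A ball about the fixed point c is mapped into itself by \<rho>, so lying in Q it
    also lies in P. This gives P an interior.\<close>
  have ballP: "ball c \<delta> \<subseteq> P"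
  proof
    fix x assume "x \<in> ball c \<delta>"
    moreover then have "\<rho> x \<in> ball c \<delta>"
      using iso[of c x] \<rho>c by simp
    ultimately show "x \<in> P" using inP[of x] \<delta>(2) \<open>O' \<subseteq> Q\<close> by blast
  qed
  then have "interior P \<noteq> {}" "c \<in> P"
    using \<delta>(1) interior_maximal[OF ballP open_ball] by auto
  moreover have "V \<inter> ball 0 M \<subseteq> P"
  proof
    fix x assume x: "x \<in> V \<inter> ball 0 M"
    then have "norm x < R" unfolding R_def using norm_ge_zero[of c] by (simp del: norm_ge_zero)
    then have "x \<in> Q" using x b by (auto simp: Q_def)
    have d: "dist (\<rho> x) (2 *\<^sub>R c) < M"
      using x iso[of x 0] \<rho>0 by (simp add: dist_norm)
    have "norm (\<rho> x) \<le> norm (\<rho> x - 2 *\<^sub>R c) + norm (2 *\<^sub>R c)"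
      using norm_triangle_ineq[of "\<rho> x - 2 *\<^sub>R c" "2 *\<^sub>R c"] by simp
    then have "norm (\<rho> x) < R" using d unfolding R_def by (simp add: dist_norm)
    then have "\<rho> x \<in> Q" using V_far[OF d] b by (auto simp: Q_def)
    then show "x \<in> P" using inP \<open>x \<in> Q\<close> by blast
  qed
  moreover have "P \<subseteq> V" by (auto simp: P_def Q_def)
  ultimately show ?thesis
    using \<open>polytope P\<close> flat \<rho> \<open>\<rho> ` P = P\<close> c_strict
    unfolding convex_polytope_iff_polytope symmetric_about_def by blast
qed

section \<open>Voronoi regions on the helix\<close>

lemma dist_square:
  fixes x p :: "'a::real_inner"
  shows "(dist x p)\<^sup>2 = x \<bullet> x - 2 * (x \<bullet> p) + p \<bullet> p"
  by (simp add: dist_norm power2_norm_eq_inner inner_diff inner_commute)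

lemma dist_le_iff_inner:
  fixes x p q :: "'a::real_inner"
  shows "dist x p \<le> dist x q \<longleftrightarrow> (q - p) \<bullet> x \<le> (q \<bullet> q - p \<bullet> p) / 2"
proof -
  have "dist x p \<le> dist x q \<longleftrightarrow> (dist x p)\<^sup>2 \<le> (dist x q)\<^sup>2"
    by (simp add: power_mono_iff)
  moreover have "(q - p) \<bullet> x = x \<bullet> q - x \<bullet> p"
    by (simp add: inner_diff_left inner_commute[of x])
  ultimately show ?thesis
    unfolding dist_square by (auto simp: field_simps)
qed

lemma dist_eq_iff_inner:
  fixes x p q :: "'a::real_inner"
  shows "dist x p = dist x q \<longleftrightarrow> (q - p) \<bullet> x = (q \<bullet> q - p \<bullet> p) / 2"
proof -
  have "dist x p = dist x q \<longleftrightarrow> dist x p \<le> dist x q \<and> dist x q \<le> dist x p" by auto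
  moreover have "(p - q) \<bullet> x = - ((q - p) \<bullet> x)" by (simp add: inner_diff_left)
  ultimately show ?thesis
    unfolding dist_le_iff_inner by (auto simp: field_simps)
qed

section \<open>Coordinates, the helix and its screw motions\<close>

locale helix =
  fixes e :: "nat \<Rightarrow> 'a::euclidean_space" and k :: nat
  assumes basis: "bij_betw e {..2 * k} Basis"
begin

definition vec :: "real \<Rightarrow> (nat \<Rightarrow> real) \<Rightarrow> (nat \<Rightarrow> real) \<Rightarrow> 'a" where
  "vec c a b = c *\<^sub>R e 0 + (\<Sum>l<k. a l *\<^sub>R e (2 * l + 1) + b l *\<^sub>R e (2 * l + 2))"

definition curve :: "real \<Rightarrow> 'a" where
  "curve t = vec t (\<lambda>l. cos (real (Suc l) * t)) (\<lambda>l. sin (real (Suc l) * t))"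

text \<open>The velocity of \<open>curve\<close>: by \<open>inner_tangent\<close>, pairing with it
  is the derivative of the function in \<open>inner_curve\<close>.\<close>

definition tangent :: "real \<Rightarrow> 'a" where
  "tangent t = vec 1 (\<lambda>l. - real (Suc l) * sin (real (Suc l) * t)) (\<lambda>l. real (Suc l) * cos (real (Suc l) * t))"

text \<open>Rotation through the angle (l + 1) s in the plane of coordinates 2 l + 1 and 2 l + 2,
  for each l, with translation by s along the axis. This motion slides the helix along
  itself.\<close>

definition screw :: "real \<Rightarrow> 'a \<Rightarrow> 'a" where
  "screw s x = vec (x \<bullet> e 0 + s)
     (\<lambda>l. cos (real (Suc l) * s) * (x \<bullet> e (2 * l + 1)) - sin (real (Suc l) * s) * (x \<bullet> e (2 * l + 2)))
     (\<lambda>l. sin (real (Suc l) * s) * (x \<bullet> e (2 * l + 1)) + cos (real (Suc l) * s) * (x \<bullet> e (2 * l + 2)))"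

lemma DIM_eq: "DIM('a) = 2 * k + 1"
  using bij_betw_same_card[OF basis] by simp

lemma inner_e: "i \<le> 2 * k \<Longrightarrow> j \<le> 2 * k \<Longrightarrow> e i \<bullet> e j = (if i = j then 1 else 0)"
  using inner_Basis[of "e i" "e j"] inj_on_eq_iff[OF bij_betw_imp_inj_on[OF basis], of i j]
    bij_betwE[OF basis] by auto

lemma inner_vec: "x \<bullet> vec c a b = c * (x \<bullet> e 0) + (\<Sum>l<k. a l * (x \<bullet> e (2 * l + 1)) + b l * (x \<bullet> e (2 * l + 2)))"
  by (simp add: vec_def inner_add_right inner_sum_right)

lemma vec_inner [simp]:
  "vec c a b \<bullet> e 0 = c"
  "l < k \<Longrightarrow> vec c a b \<bullet> e (Suc (2 * l)) = a l"
  "l < k \<Longrightarrow> vec c a b \<bullet> e (Suc (Suc (2 * l))) = b l"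
proof -
  show "vec c a b \<bullet> e 0 = c"
    by (simp add: vec_def inner_add_left inner_sum_left inner_e)
  assume l: "l < k"
  have "(\<Sum>m<k. (a m *\<^sub>R e (2 * m + 1) + b m *\<^sub>R e (2 * m + 2)) \<bullet> e (Suc (2 * l))) = (\<Sum>m<k. if m = l then a m else 0)"
    using l by (intro sum.cong refl) (auto simp: inner_add_left inner_e Suc_double_not_eq_double)
  then show "vec c a b \<bullet> e (Suc (2 * l)) = a l"
    using l by (simp add: vec_def inner_add_left[of "c *\<^sub>R e 0"] inner_sum_left inner_e del: sum.lessThan_Suc)
  have "(\<Sum>m<k. (a m *\<^sub>R e (2 * m + 1) + b m *\<^sub>R e (2 * m + 2)) \<bullet> e (Suc (Suc (2 * l)))) = (\<Sum>m<k. if m = l then b m else 0)"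
    using l by (intro sum.cong refl) (auto simp: inner_add_left inner_e double_not_eq_Suc_double)
  then show "vec c a b \<bullet> e (Suc (Suc (2 * l))) = b l"
    using l by (simp add: vec_def inner_add_left[of "c *\<^sub>R e 0"] inner_sum_left inner_e)
qed

lemma inner_eq_coords:
  "x \<bullet> y = (x \<bullet> e 0) * (y \<bullet> e 0) +
     (\<Sum>l<k. (x \<bullet> e (2 * l + 1)) * (y \<bullet> e (2 * l + 1)) + (x \<bullet> e (2 * l + 2)) * (y \<bullet> e (2 * l + 2)))"
proof -
  have split: "(\<Sum>i\<le>2 * m. g i) = g 0 + (\<Sum>l<m. g (2 * l + 1) + g (2 * l + 2))" for g :: "nat \<Rightarrow> real" and m
    by (induction m) (simp_all add: add.assoc)
  have "x \<bullet> y = (\<Sum>b\<in>Basis. (x \<bullet> b) * (y \<bullet> b))" by (rule euclidean_inner)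
  also have "\<dots> = (\<Sum>i\<le>2 * k. (x \<bullet> e i) * (y \<bullet> e i))"
    by (rule sum.reindex_bij_betw[OF basis, symmetric])
  finally show ?thesis unfolding split .
qed

lemma eqI_coords:
  assumes "x \<bullet> e 0 = y \<bullet> e 0"
    and "\<And>l. l < k \<Longrightarrow> x \<bullet> e (Suc (2 * l)) = y \<bullet> e (Suc (2 * l))"
    and "\<And>l. l < k \<Longrightarrow> x \<bullet> e (Suc (Suc (2 * l))) = y \<bullet> e (Suc (Suc (2 * l)))"
  shows "x = y"
proof -
  have "(x - y) \<bullet> (x - y) = 0"
    unfolding inner_eq_coords[of "x - y" "x - y"] using assms by (simp add: inner_diff_left sum.neutral)
  then show ?thesis by simp
qed

lemma inj_curve: "inj curve"
  by (rule injI) (metis curve_def vec_inner(1))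

lemma isometry_screw: "isometry (screw s)"
proof -
  have rot: "(c * x - d * y)\<^sup>2 + (d * x + c * y)\<^sup>2 = x\<^sup>2 + y\<^sup>2" if "c\<^sup>2 + d\<^sup>2 = 1" for c d x y :: real
  proof -
    have "(c * x - d * y)\<^sup>2 + (d * x + c * y)\<^sup>2 = (c\<^sup>2 + d\<^sup>2) * (x\<^sup>2 + y\<^sup>2)"
      by (simp add: power2_eq_square algebra_simps)
    then show ?thesis using that by simp
  qed
  have "(dist (screw s x) (screw s y))\<^sup>2 = (dist x y)\<^sup>2" for x y
  proof -
    let ?c = "\<lambda>l. cos (real (Suc l) * s)" and ?d = "\<lambda>l. sin (real (Suc l) * s)"
    define z where "z = x - y"
    define p q where "p l = z \<bullet> e (2 * l + 1)" and "q l = z \<bullet> e (2 * l + 2)" for l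
    have "(dist (screw s x) (screw s y))\<^sup>2 = (screw s x - screw s y) \<bullet> (screw s x - screw s y)"
      by (simp add: dist_norm power2_norm_eq_inner)
    also have "\<dots> = (z \<bullet> e 0)\<^sup>2 + (\<Sum>l<k. (?c l * p l - ?d l * q l)\<^sup>2 + (?d l * p l + ?c l * q l)\<^sup>2)"
    proof -
      have "(screw s x - screw s y) \<bullet> e (2 * l + 1) = ?c l * p l - ?d l * q l"
        "(screw s x - screw s y) \<bullet> e (2 * l + 2) = ?d l * p l + ?c l * q l" if "l < k" for l
        using that by (simp_all add: screw_def z_def p_def q_def inner_diff_left right_diff_distrib del: of_nat_Suc)
      moreover have "(screw s x - screw s y) \<bullet> e 0 = z \<bullet> e 0"
        by (simp add: screw_def z_def inner_diff_left)
      ultimately show ?thesis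
        unfolding inner_eq_coords[of "screw s x - screw s y" "screw s x - screw s y"] power2_eq_square by simp
    qed
    also have "\<dots> = (z \<bullet> e 0)\<^sup>2 + (\<Sum>l<k. (p l)\<^sup>2 + (q l)\<^sup>2)"
      by (simp only: rot[OF sin_cos_squared_add2])
    also have "\<dots> = z \<bullet> z"
      unfolding inner_eq_coords[of z z] p_def q_def by (simp add: power2_eq_square)
    finally show ?thesis by (simp add: z_def dist_norm power2_norm_eq_inner)
  qed
  then show ?thesis
    unfolding isometry_def by (metis power2_eq_iff_nonneg zero_le_dist)
qed

lemma dist_screw [simp]: "dist (screw s x) (screw s y) = dist x y"
  using isometry_screw by (simp add: isometry_def)

lemma screw_screw_uminus [simp]: "screw s (screw (- s) x) = x"
proof (rule eqI_coords)
  have rot: "c * (c * x + d * y) - d * (- d * x + c * y) = x" "d * (c * x + d * y) + c * (- d * x + c * y) = y"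
    if "c\<^sup>2 + d\<^sup>2 = 1" for c d x y :: real
  proof -
    have "c * (c * x + d * y) - d * (- d * x + c * y) = (c\<^sup>2 + d\<^sup>2) * x"
      "d * (c * x + d * y) + c * (- d * x + c * y) = (c\<^sup>2 + d\<^sup>2) * y"
      by (simp_all add: power2_eq_square algebra_simps)
    then show "c * (c * x + d * y) - d * (- d * x + c * y) = x" "d * (c * x + d * y) + c * (- d * x + c * y) = y"
      using that by simp_all
  qed
  show "screw s (screw (- s) x) \<bullet> e 0 = x \<bullet> e 0"
    by (simp add: screw_def)
  fix l assume "l < k"
  then show "screw s (screw (- s) x) \<bullet> e (Suc (2 * l)) = x \<bullet> e (Suc (2 * l))"
    "screw s (screw (- s) x) \<bullet> e (Suc (Suc (2 * l))) = x \<bullet> e (Suc (Suc (2 * l)))"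
    using rot[OF sin_cos_squared_add2, of "real (Suc l) * s" "x \<bullet> e (Suc (2 * l))" "x \<bullet> e (Suc (Suc (2 * l)))"]
    by (simp_all add: screw_def del: of_nat_Suc)
qed

lemma screw_uminus_screw [simp]: "screw (- s) (screw s x) = x"
  using screw_screw_uminus[of "- s" x] by simp

lemma screw_curve: "screw s (curve t) = curve (t + s)"
  by (rule eqI_coords)
    (simp_all add: screw_def curve_def cos_add sin_add distrib_left del: of_nat_Suc)

lemma dist_screw_uminus_curve: "dist (screw (- t) x) (curve j) = dist x (curve (t + j))"
  using dist_screw[of t "screw (- t) x" "curve j"] by (simp add: screw_curve add.commute)

lemma mem_screw_image: "x \<in> screw t ` P \<longleftrightarrow> screw (- t) x \<in> P"
proof
  show "x \<in> screw t ` P \<Longrightarrow> screw (- t) x \<in> P" by auto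
  show "screw (- t) x \<in> P \<Longrightarrow> x \<in> screw t ` P" by (rule image_eqI[of _ _ "screw (- t) x"]) auto
qed

section \<open>Distance to the helix as a function of the parameter\<close>

lemma inner_curve:
  "x \<bullet> curve t + \<gamma> = quad_trig k \<gamma> (x \<bullet> e 0) 0 (\<lambda>l. x \<bullet> e (2 * l + 1)) (\<lambda>l. x \<bullet> e (2 * l + 2)) t"
  unfolding curve_def inner_vec quad_trig_def by (simp add: mult.commute)

lemma inner_tangent:
  "x \<bullet> tangent t = quad_trig k (x \<bullet> e 0) 0 0
     (\<lambda>l. real (Suc l) * (x \<bullet> e (2 * l + 2))) (\<lambda>l. - real (Suc l) * (x \<bullet> e (2 * l + 1))) t"
  unfolding tangent_def inner_vec quad_trig_def
  by (simp del: of_nat_Suc add: mult_ac add.commute)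

lemma curve_inner_curve: "curve t \<bullet> curve t = t\<^sup>2 + real k"
proof -
  have "curve t \<bullet> curve t = t\<^sup>2 + (\<Sum>l<k. (cos (real (Suc l) * t))\<^sup>2 + (sin (real (Suc l) * t))\<^sup>2)"
    unfolding inner_eq_coords[of "curve t" "curve t"] by (simp add: curve_def power2_eq_square)
  also have "\<dots> = t\<^sup>2 + real k" by simp
  finally show ?thesis .
qed

text \<open>Each cosine and sine pair has norm 1, so the squared norm of \<open>curve t\<close>
  contributes only t^2 + k. This brings the zero counts to bear on spheres, with \<gamma> as squared
  radius.\<close>

lemma dist_curve_square:
  "(dist x (curve t))\<^sup>2 - \<gamma> = quad_trig k (x \<bullet> x + real k - \<gamma>) (- 2 * (x \<bullet> e 0)) 1
     (\<lambda>l. - 2 * (x \<bullet> e (2 * l + 1))) (\<lambda>l. - 2 * (x \<bullet> e (2 * l + 2))) t"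
proof -
  have "(\<Sum>l<k. - 2 * (x \<bullet> e (2 * l + 1)) * cos (real (Suc l) * t) + - 2 * (x \<bullet> e (2 * l + 2)) * sin (real (Suc l) * t))
      = - 2 * (\<Sum>l<k. cos (real (Suc l) * t) * (x \<bullet> e (2 * l + 1)) + sin (real (Suc l) * t) * (x \<bullet> e (2 * l + 2)))"
    unfolding sum_distrib_left by (intro sum.cong) (simp_all del: of_nat_Suc add: algebra_simps)
  moreover have "x \<bullet> curve t = t * (x \<bullet> e 0) + (\<Sum>l<k. cos (real (Suc l) * t) * (x \<bullet> e (2 * l + 1)) + sin (real (Suc l) * t) * (x \<bullet> e (2 * l + 2)))"
    unfolding curve_def inner_vec ..
  ultimately show ?thesis
    unfolding dist_square curve_inner_curve quad_trig_def by (simp del: of_nat_Suc)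
qed

text \<open>There are 2 (k + 1) conditions on a pair (x, \<gamma>) from a space of dimension (2 k +
  1) + 1, and \<open>quad_trig_double_zeros_eq_0\<close> shows that the homogeneous problem has only
  the zero solution.\<close>

lemma Hermite_interpolation:
  assumes S: "finite S" "card S = Suc k" "S \<subseteq> {lo..hi}" and len: "hi - lo < 2 * pi"
  shows "\<exists>x \<gamma>. \<forall>t\<in>S. x \<bullet> curve t + \<gamma> = y t \<and> x \<bullet> tangent t = y' t"
proof -
  \<comment> \<open>The flag selects the condition at a node: \<open>True\<close> for the value,
    \<open>False\<close> for the slope.\<close>
  define \<psi> :: "real \<times> bool \<Rightarrow> 'a \<times> real \<Rightarrow> real" where
    "\<psi> i v = (if snd i then fst v \<bullet> curve (fst i) + snd v else fst v \<bullet> tangent (fst i))" for i v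
  have "\<exists>v. \<forall>i\<in>S \<times> UNIV. \<psi> i v = (if snd i then y (fst i) else y' (fst i))"
  proof (rule functional_interpolation)
    show "card (S \<times> (UNIV :: bool set)) = DIM('a \<times> real)"
      using S(2) by (simp add: card_cartesian_product DIM_eq)
    show "linear (\<psi> i)" for i
      by (rule linearI) (auto simp: \<psi>_def inner_add_left algebra_simps)
    show "v = 0" if *: "\<And>i. i \<in> S \<times> UNIV \<Longrightarrow> \<psi> i v = 0" for v
    proof -
      obtain x \<gamma> where v: "v = (x, \<gamma>)" by (cases v)
      have "\<gamma> = 0 \<and> x \<bullet> e 0 = 0 \<and> (\<forall>l<k. x \<bullet> e (2 * l + 1) = 0 \<and> x \<bullet> e (2 * l + 2) = 0)"
      proof (rule quad_trig_double_zeros_eq_0[OF S len])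
        fix t assume "t \<in> S"
        then show "quad_trig k \<gamma> (x \<bullet> e 0) 0 (\<lambda>l. x \<bullet> e (2 * l + 1)) (\<lambda>l. x \<bullet> e (2 * l + 2)) t = 0"
          using *[of "(t, True)"] unfolding inner_curve[symmetric] by (simp add: \<psi>_def v)
        show "quad_trig k (x \<bullet> e 0) 0 0 (\<lambda>l. real (Suc l) * (x \<bullet> e (2 * l + 2))) (\<lambda>l. - real (Suc l) * (x \<bullet> e (2 * l + 1))) t = 0"
          using *[of "(t, False)"] \<open>t \<in> S\<close> unfolding inner_tangent[symmetric] by (simp add: \<psi>_def v)
      qed
      then have "x = 0" "\<gamma> = 0" by (auto intro!: eqI_coords)
      then show ?thesis by (simp add: v zero_prod_def)
    qed
  qed (use S in auto)
  then obtain v where "\<And>i. i \<in> S \<times> UNIV \<Longrightarrow> \<psi> i v = (if snd i then y (fst i) else y' (fst i))" by blast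
  from this[of "(_, True)"] this[of "(_, False)"] show ?thesis
    by (intro exI[of _ "fst v"] exI[of _ "snd v"]) (auto simp: \<psi>_def)
qed

text \<open>Matching t^2 / 2 in value and slope on S makes the squared distance minus a constant
  vanish to second order there, so \<open>quad_trig_pos_off_double_zeros\<close> applies.\<close>

lemma empty_sphere:
  assumes S: "finite S" "card S = Suc k" "S \<subseteq> {lo..hi}" and len: "hi - lo < 2 * pi / real (Suc k)"
  shows "\<exists>x R. (\<forall>t\<in>S. dist x (curve t) = R) \<and> (\<forall>s\<in>{lo..hi} - S. dist x (curve s) > R)"
proof -
  have "2 * pi / real (Suc k) \<le> 2 * pi / 1"
    by (intro divide_left_mono) auto
  then have "hi - lo < 2 * pi" using len by simp
  then obtain x \<gamma> where x: "\<And>t. t \<in> S \<Longrightarrow> x \<bullet> curve t + \<gamma> = t\<^sup>2 / 2" "\<And>t. t \<in> S \<Longrightarrow> x \<bullet> tangent t = t"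
    using Hermite_interpolation[OF S, of "\<lambda>t. t\<^sup>2 / 2" "\<lambda>t. t"] by blast
  \<comment> \<open>The squared distance at a node, after substituting the interpolation condition;
    the radius of the sphere is its square root.\<close>
  define R where "R = x \<bullet> x + real k + 2 * \<gamma>"
  let ?F = "quad_trig k (x \<bullet> x + real k - R) (- 2 * (x \<bullet> e 0)) 1 (\<lambda>l. - 2 * (x \<bullet> e (2 * l + 1))) (\<lambda>l. - 2 * (x \<bullet> e (2 * l + 2)))"
  have zero: "(dist x (curve t))\<^sup>2 = R" if "t \<in> S" for t
    unfolding dist_square curve_inner_curve R_def using x(1)[OF that] by simp
  have zero': "quad_trig k (- 2 * (x \<bullet> e 0)) 2 0 (\<lambda>l. real (Suc l) * (- 2 * (x \<bullet> e (2 * l + 2))))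
      (\<lambda>l. - real (Suc l) * (- 2 * (x \<bullet> e (2 * l + 1)))) t = 0" if "t \<in> S" for t
  proof -
    have "quad_trig k (- 2 * (x \<bullet> e 0)) 2 0 (\<lambda>l. real (Suc l) * (- 2 * (x \<bullet> e (2 * l + 2))))
        (\<lambda>l. - real (Suc l) * (- 2 * (x \<bullet> e (2 * l + 1)))) t = 2 * t - 2 * (x \<bullet> tangent t)"
      unfolding inner_tangent quad_trig_def right_diff_distrib distrib_left sum_distrib_left
      by (simp del: of_nat_Suc add: algebra_simps sum_subtractf sum_negf sum.distrib)
    then show ?thesis using x(2)[OF that] by simp
  qed
  have pos: "(dist x (curve s))\<^sup>2 - R > 0" if "s \<in> {lo..hi} - S" for s
    unfolding dist_curve_square
  proof (rule quad_trig_pos_off_double_zeros[OF S len _ zero' that])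
    show "?F t = 0" if "t \<in> S" for t
      unfolding dist_curve_square[symmetric] using zero[OF that] by simp
  qed
  have "dist x (curve t) = sqrt R" if "t \<in> S" for t
    using zero[OF that] by (metis real_sqrt_unique zero_le_dist)
  moreover have "dist x (curve s) > sqrt R" if "s \<in> {lo..hi} - S" for s
    using pos[OF that] by (intro real_less_lsqrt real_less_rsqrt) auto
  ultimately show ?thesis by blast
qed

text \<open>E is the translate by x0 of the orthogonal complement of k differences of curve points.
  These are linearly independent, so the dimension is (2 k + 1) - k.\<close>

lemma equidistant_aff_dim:
  assumes S: "finite S" "card S = Suc k" "S \<subseteq> {lo..hi}" and len: "hi - lo < 2 * pi"
  defines "E \<equiv> {x. \<forall>s\<in>S. \<forall>t\<in>S. dist x (curve s) = dist x (curve t)}"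
  assumes "x0 \<in> E"
  shows "affine E" "aff_dim E = int k + 1"
proof -
  obtain t0 where t0: "t0 \<in> S" using S(2) by fastforce
  define D where "D = (\<lambda>t. curve t - curve t0) ` (S - {t0})"
  define W where "W = {y \<in> UNIV. \<forall>d\<in>span D. orthogonal d y}"
  have inj: "inj_on (\<lambda>t. curve t - curve t0) (S - {t0})"
    using inj_curve by (auto simp: inj_on_def)
  have "card D = k"
    unfolding D_def card_image[OF inj] using S(1,2) t0 by simp
  moreover have "independent D"
  proof
    assume "dependent D"
    then obtain a where a: "a \<in> D" "a \<in> span (D - {a})" unfolding dependent_def by blast
    then obtain t1 where t1: "t1 \<in> S" "t1 \<noteq> t0" "a = curve t1 - curve t0" by (auto simp: D_def)
    \<comment> \<open>Interpolation separates t1 from the other nodes: x is orthogonal to every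
      difference except the one at t1, which therefore is not in the span of the rest.\<close>
    obtain x \<gamma> where x: "\<And>t. t \<in> S \<Longrightarrow> x \<bullet> curve t + \<gamma> = (if t = t1 then 1 else 0)"
      using Hermite_interpolation[OF S len, of "\<lambda>t. if t = t1 then 1 else 0" "\<lambda>_. 0"] by blast
    have "x \<bullet> d = 0" if d: "d \<in> D - {a}" for d
    proof -
      obtain t where "t \<in> S" "t \<noteq> t1" "d = curve t - curve t0" using d t1(3) by (auto simp: D_def)
      then show ?thesis using x[of t] x[OF t0] t1(2) by (simp add: inner_diff_right)
    qed
    then have "span (D - {a}) \<subseteq> {y. x \<bullet> y = 0}"
      by (intro span_minimal subspace_hyperplane) auto
    then have "x \<bullet> a = 0" using a(2) by blast
    then show False using x[OF t1(1)] x[OF t0] t1 by (simp add: inner_diff_right)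
  qed
  ultimately have "dim (span D) = k"
    using dim_eq_card_independent[of D] by simp
  then have dimW: "dim W = k + 1"
    using dim_subspace_orthogonal_to_vectors[of "span D" UNIV] unfolding W_def by (simp add: DIM_eq)
  have W_iff: "y \<in> W \<longleftrightarrow> (\<forall>d\<in>D. d \<bullet> y = 0)" for y
  proof
    assume "y \<in> W" then show "\<forall>d\<in>D. d \<bullet> y = 0"
      using span_base by (auto simp: W_def orthogonal_def)
  next
    assume "\<forall>d\<in>D. d \<bullet> y = 0"
    then have "span D \<subseteq> {d. y \<bullet> d = 0}"
      by (intro span_minimal subspace_hyperplane) (auto simp: inner_commute)
    then show "y \<in> W" by (auto simp: W_def orthogonal_def inner_commute)
  qed
  have subW: "subspace W"
    unfolding subspace_def by (auto simp: W_iff inner_add_right)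
  have E_iff: "x \<in> E \<longleftrightarrow> (\<forall>t\<in>S. dist x (curve t0) = dist x (curve t))" for x
    unfolding E_def using t0 by auto metis
  have "x \<in> E \<longleftrightarrow> x - x0 \<in> W" for x
  proof -
    have "dist x (curve t0) = dist x (curve t) \<longleftrightarrow> (curve t - curve t0) \<bullet> (x - x0) = 0" if "t \<in> S" for t
      using \<open>x0 \<in> E\<close> that unfolding E_iff dist_eq_iff_inner inner_diff_right by auto
    then show ?thesis unfolding E_iff W_iff D_def by auto
  qed
  then have "E = (+) x0 ` W"
    by (force simp: image_iff)
  then show "affine E" "aff_dim E = int k + 1"
    using subW dimW
    by (simp_all add: affine_translation[symmetric] subspace_imp_affine aff_dim_subspace aff_dim_translation_eq)
qed

text \<open>\<open>quad_trig_not_nonneg\<close> for spheres, with squared radius R^2; squaring the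
  inequalities uses \<open>R \<ge> 0\<close>.\<close>

lemma dist_square_window:
  assumes T: "finite T" "card T = k + 2" and "\<epsilon> > 0"
    and sep: "\<And>s t. s \<in> T \<Longrightarrow> t \<in> T \<Longrightarrow> s \<noteq> t \<Longrightarrow> 2 * \<epsilon> < \<bar>s - t\<bar>"
    and bnd: "\<And>t. t \<in> T \<Longrightarrow> lo \<le> t - \<epsilon> \<and> t + \<epsilon> \<le> hi" and len: "hi - lo < 2 * pi"
    and eq: "\<And>t. t \<in> T \<Longrightarrow> dist x (curve t) = R"
    and ge: "\<And>t. t \<in> T \<Longrightarrow> dist x (curve (t - \<epsilon>)) \<ge> R" "\<And>t. t \<in> T \<Longrightarrow> dist x (curve (t + \<epsilon>)) \<ge> R"
  shows False
proof -
  have "R \<ge> 0"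
  proof -
    obtain t where "t \<in> T" using T(2) by fastforce
    then show ?thesis using eq[of t] zero_le_dist[of x "curve t"] by simp
  qed
  show False
  proof (rule quad_trig_not_nonneg[OF T \<open>\<epsilon> > 0\<close> sep bnd len])
    fix t assume t: "t \<in> T"
    show "quad_trig k (x \<bullet> x + real k - R\<^sup>2) (- 2 * (x \<bullet> e 0)) 1
      (\<lambda>l. - 2 * (x \<bullet> e (2 * l + 1))) (\<lambda>l. - 2 * (x \<bullet> e (2 * l + 2))) t = 0"
      unfolding dist_curve_square[symmetric] using eq[OF t] by simp
    show "quad_trig k (x \<bullet> x + real k - R\<^sup>2) (- 2 * (x \<bullet> e 0)) 1
      (\<lambda>l. - 2 * (x \<bullet> e (2 * l + 1))) (\<lambda>l. - 2 * (x \<bullet> e (2 * l + 2))) (t - \<epsilon>) \<ge> 0"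
      "quad_trig k (x \<bullet> x + real k - R\<^sup>2) (- 2 * (x \<bullet> e 0)) 1
      (\<lambda>l. - 2 * (x \<bullet> e (2 * l + 1))) (\<lambda>l. - 2 * (x \<bullet> e (2 * l + 2))) (t + \<epsilon>) \<ge> 0"
      unfolding dist_curve_square[symmetric]
      using power_mono[OF ge(1)[OF t] \<open>R \<ge> 0\<close>, of 2] power_mono[OF ge(2)[OF t] \<open>R \<ge> 0\<close>, of 2] by simp_all
  qed auto
qed

section \<open>Choice of parameters and assembly of the family\<close>

lemma neighborly_family_exists:
  assumes "k \<ge> 1" "n \<ge> 1" "r \<le> 2 * k"
  shows "\<exists>F :: 'a set set. finite F \<and> card F = n \<and> (\<forall>P\<in>F. convex_polytope P) \<and>
    (\<forall>P\<in>F. \<forall>Q\<in>F. congruent_sets P Q) \<and> neighborly (k + 1) F \<and>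
    (\<forall>P\<in>F. \<exists>f. flat r f \<and> symmetric_about P f)"
proof -
  \<comment> \<open>Makes the whole window, of length 9 n \<epsilon>, as long as 1 / (k + 1), hence
    shorter than 2 pi / (k + 1).\<close>
  define \<epsilon> where "\<epsilon> = 1 / (9 * real n * real (Suc k))"
  have \<epsilon>: "\<epsilon> > 0" using assms(2) by (simp add: \<epsilon>_def)
  have n\<epsilon>: "9 * real n * \<epsilon> = 1 / real (Suc k)"
    using assms(2) by (simp add: \<epsilon>_def del: of_nat_Suc)
  \<comment> \<open>The centres sit at every third grid point. The offsets J contain all differences
    of distinct centres, so members are compared with each other, and also \<epsilon> and
    -\<epsilon>, whose points lie between centres.\<close>
  define T where "T = (\<lambda>i. real i * (3 * \<epsilon>)) ` {..<n}"
  define J where "J = (\<lambda>j. real_of_int j * \<epsilon>) ` ({- 3 * int n..3 * int n} - {0})"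
  \<comment> \<open>Together with \<open>hi\<close> this bounds every parameter t + j with t in T
    and j in J.\<close>
  define lo where "lo = - (3 * real n * \<epsilon>)"
  define hi where "hi = 6 * real n * \<epsilon>"
  have len: "hi - lo < 2 * pi / real (Suc k)"
  proof -
    have "hi - lo = 1 / real (Suc k)" unfolding n\<epsilon>[symmetric] hi_def lo_def by simp
    also have "\<dots> < 2 * pi / real (Suc k)" using pi_ge_two by (intro divide_strict_right_mono) auto
    finally show ?thesis .
  qed
  have len2: "hi - lo < 2 * pi"
  proof -
    have "2 * pi / real (Suc k) \<le> 2 * pi / 1" by (intro divide_left_mono) auto
    then show ?thesis using len by simp
  qed
  have finT: "finite T" and finJ: "finite J" by (simp_all add: T_def J_def)
  have cardT: "card T = n"
    unfolding T_def using \<epsilon> by (subst card_image) (auto simp: inj_on_def)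
  have Tb: "0 \<le> t \<and> t \<le> 3 * real n * \<epsilon> - 3 * \<epsilon>" if t: "t \<in> T" for t
  proof -
    obtain i where i: "i < n" "t = real i * (3 * \<epsilon>)" using t by (auto simp: T_def)
    have "t \<le> (real n - 1) * (3 * \<epsilon>)"
      unfolding i(2) using i(1) \<epsilon> by (intro mult_right_mono) linarith+
    then show ?thesis using i(2) \<epsilon> by (simp add: algebra_simps)
  qed
  have Jb: "j \<noteq> 0 \<and> \<bar>j\<bar> \<le> 3 * real n * \<epsilon>" if j: "j \<in> J" for j
  proof -
    obtain i :: int where "i \<in> {- 3 * int n..3 * int n} - {0}" and i: "j = real_of_int i * \<epsilon>"
      using j unfolding J_def by blast
    then have "i \<noteq> 0" "\<bar>real_of_int i\<bar> \<le> 3 * real n" by auto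
    then have "\<bar>real_of_int i\<bar> * \<epsilon> \<le> 3 * real n * \<epsilon>" using \<epsilon> by (intro mult_right_mono) auto
    then show ?thesis using i \<epsilon> \<open>i \<noteq> 0\<close> by (simp add: abs_mult)
  qed
  have TJ: "t + j \<in> {lo..hi}" if "t \<in> T" "j \<in> J" for t j
    using Tb[OF that(1)] Jb[OF that(2)] \<epsilon> by (auto simp: lo_def hi_def)
  have T_sub: "T \<subseteq> {lo..hi}"
  proof
    fix t assume "t \<in> T"
    then show "t \<in> {lo..hi}" using Tb[of t] \<epsilon> mult_nonneg_nonneg[of "real n" \<epsilon>] by (auto simp: lo_def hi_def)
  qed
  have J\<epsilon>: "\<epsilon> \<in> J" "- \<epsilon> \<in> J"
  proof -
    show "\<epsilon> \<in> J"
      unfolding J_def by (rule image_eqI[of _ _ 1]) (use assms(2) in auto)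
    show "- \<epsilon> \<in> J"
      unfolding J_def by (rule image_eqI[of _ _ "-1"]) (use assms(2) in auto)
  qed
  have diffT: "t - s \<in> J" "2 * \<epsilon> < \<bar>s - t\<bar>" if st: "s \<in> T" "t \<in> T" "s \<noteq> t" for s t
  proof -
    obtain i where i: "i < n" "s = real i * (3 * \<epsilon>)" using st by (auto simp: T_def)
    obtain j where j: "j < n" "t = real j * (3 * \<epsilon>)" using st by (auto simp: T_def)
    have "i \<noteq> j" using st i j by auto
    have "t - s = real_of_int (3 * (int j - int i)) * \<epsilon>" by (simp add: i j algebra_simps)
    moreover have "3 * (int j - int i) \<in> {- 3 * int n..3 * int n} - {0}"
      using i(1) j(1) \<open>i \<noteq> j\<close> by auto
    ultimately show "t - s \<in> J" unfolding J_def by (rule image_eqI)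
    have "s - t = (real i - real j) * (3 * \<epsilon>)" by (simp add: i j algebra_simps)
    then have "\<bar>s - t\<bar> = \<bar>real i - real j\<bar> * (3 * \<epsilon>)"
      using \<epsilon> by (simp add: abs_mult)
    moreover have "1 * (3 * \<epsilon>) \<le> \<bar>real i - real j\<bar> * (3 * \<epsilon>)"
      using \<open>i \<noteq> j\<close> \<epsilon> by (intro mult_right_mono) auto
    ultimately show "2 * \<epsilon> < \<bar>s - t\<bar>" using \<epsilon> by linarith
  qed

  define u where "u j = (curve j \<bullet> curve j - curve 0 \<bullet> curve 0) / 2" for j
  \<comment> \<open>The region of \<open>curve 0\<close> relative to the offsets J. As J does not
    depend on the centre, screw motions carry this region to those of all other centres.\<close>
  define V where "V = {x. \<forall>j\<in>J. (curve j - curve 0) \<bullet> x \<le> u j}"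
  have V_iff: "x \<in> V \<longleftrightarrow> (\<forall>j\<in>J. dist x (curve 0) \<le> dist x (curve j))" for x
    unfolding V_def u_def dist_le_iff_inner by simp

  have "\<exists>x R. (\<forall>t\<in>S. dist x (curve t) = R) \<and> (\<forall>s\<in>{lo..hi} - S. dist x (curve s) > R)"
    if "S \<subseteq> T" "card S = Suc k" for S
    using empty_sphere[OF finite_subset[OF that(1) finT] that(2) _ len] that(1) T_sub by blast
  then obtain X R where X: "\<And>S t. S \<subseteq> T \<Longrightarrow> card S = Suc k \<Longrightarrow> t \<in> S \<Longrightarrow> dist (X S) (curve t) = R S"
    "\<And>S s. S \<subseteq> T \<Longrightarrow> card S = Suc k \<Longrightarrow> s \<in> {lo..hi} - S \<Longrightarrow> dist (X S) (curve s) > R S"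
    by metis
  \<comment> \<open>The sum exceeds every distance from a sphere centre \<open>X S\<close> to an
    image of the origin. So near \<open>X S\<close> each moved copy of P coincides with the moved
    copy of V.\<close>
  define M where "M = 1 + (\<Sum>S\<in>Pow T. \<Sum>t\<in>T. dist (X S) (screw t 0))"
  have "M \<ge> 1"
    unfolding M_def by (simp add: sum_nonneg)
  have M: "dist (X S) (screw t 0) < M" if "S \<subseteq> T" "t \<in> T" for S t
  proof -
    have "dist (X S) (screw t 0) \<le> (\<Sum>t\<in>T. dist (X S) (screw t 0))"
      using finT that(2) by (intro member_le_sum) auto
    also have "\<dots> \<le> (\<Sum>S\<in>Pow T. \<Sum>t\<in>T. dist (X S) (screw t 0))"
      using finT that(1) by (intro member_le_sum) (auto intro: sum_nonneg)
    finally show ?thesis by (simp add: M_def)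
  qed

  \<comment> \<open>The sum of all cosine directions. Every cosine is maximal at parameter 0, and
    the one of frequency 1 strictly so among the offsets, which are nonzero and shorter than a
    period; \<open>k \<ge> 1\<close> supplies this frequency.\<close>
  define v where "v = vec 0 (\<lambda>_. 1) (\<lambda>_. 0)"
  have "v \<noteq> 0"
    using vec_inner(2)[of 0 0 "\<lambda>_. 1" "\<lambda>_. 0"] assms(1) by (auto simp: v_def)
  moreover have "(curve j - curve 0) \<bullet> v < 0" if j: "j \<in> J" for j
  proof -
    have "(curve j - curve 0) \<bullet> v = (\<Sum>l<k. cos (real (Suc l) * j) - 1)"
      unfolding v_def inner_vec by (simp add: curve_def inner_diff_left del: of_nat_Suc)
    also have "\<dots> < (\<Sum>l<k. 0)"
    proof (rule sum_strict_mono_ex1)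
      have "cos j \<noteq> 1"
      proof
        assume "cos j = 1"
        then have "cis j = cis 0"
          using sin_cos_squared_add[of j] by (simp add: complex_eq_iff)
        moreover have "\<bar>j - 0\<bar> < 2 * pi"
          using Jb[OF j] len2 mult_nonneg_nonneg[OF of_nat_0_le_iff less_imp_le[OF \<epsilon>], of n]
          unfolding hi_def lo_def by linarith
        ultimately have "j = 0" by (rule cis_eq_imp_eq)
        then show False using Jb[OF j] by simp
      qed
      then have "cos j < 1" using cos_le_one[of j] by linarith
      then show "\<exists>l\<in>{..<k}. cos (real (Suc l) * j) - 1 < 0"
        using assms(1) by (intro bexI[of _ 0]) auto
    qed auto
    finally show ?thesis by simp
  qed
  moreover have "r < DIM('a)" using assms(3) DIM_eq by simp
  moreover have "M > 0" using \<open>M \<ge> 1\<close> by simp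
  ultimately obtain P f c where P: "convex_polytope P" "P \<subseteq> V" "V \<inter> ball 0 M \<subseteq> P"
    and f: "flat r f" "symmetric_about P f"
    and c: "c \<in> P" "\<forall>j\<in>J. (curve j - curve 0) \<bullet> c < u j"
    using symmetrized_polyhedron[OF finJ, of v "\<lambda>j. curve j - curve 0" r M u] unfolding V_def by blast

  have closer: "dist x (curve t) \<le> dist x (curve (t + j))" if "x \<in> screw t ` P" "j \<in> J" for x t j
  proof -
    have "screw (- t) x \<in> V" using that(1) P(2) unfolding mem_screw_image by blast
    then show ?thesis
      using that(2) dist_screw_uminus_curve[of t x 0] by (auto simp: V_iff dist_screw_uminus_curve)
  qed
  have memI: "x \<in> screw t ` P"
    if "dist x (screw t 0) < M" "\<And>j. j \<in> J \<Longrightarrow> dist x (curve t) \<le> dist x (curve (t + j))" for x t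
  proof -
    have "screw (- t) x \<in> V"
      unfolding V_iff using that(2) dist_screw_uminus_curve[of t x 0] by (auto simp: dist_screw_uminus_curve)
    moreover have "norm (screw (- t) x) < M"
      using that(1) dist_screw[of t "screw (- t) x" 0] by (simp add: dist_norm)
    ultimately show ?thesis unfolding mem_screw_image using P(3) by auto
  qed

  \<comment> \<open>The point c satisfies all inequalities of V strictly, so
    \<open>screw s c\<close> is strictly closer to \<open>curve s\<close> than to
    \<open>curve t\<close> and cannot lie in the member of t.\<close>
  have inj: "inj_on (\<lambda>t. screw t ` P) T"
  proof (rule inj_onI, rule ccontr)
    fix s t assume st: "s \<in> T" "t \<in> T" "screw s ` P = screw t ` P" "s \<noteq> t"
    have "screw s c \<in> screw t ` P" using c(1) st(3) by blast
    moreover have "s - t \<in> J" using diffT(1)[OF st(2,1)] st(4) by simp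
    ultimately have "dist (screw s c) (curve t) \<le> dist (screw s c) (curve s)"
      using closer[of "screw s c" t "s - t"] by simp
    then have "dist c (curve (t - s)) \<le> dist c (curve 0)"
      using dist_screw_uminus_curve[of s "screw s c" "t - s"] dist_screw_uminus_curve[of s "screw s c" 0] by simp
    moreover have "t - s \<in> J" using diffT(1)[OF st(1,2,4)] .
    then have "\<not> dist c (curve (t - s)) \<le> dist c (curve 0)"
      using c(2) unfolding dist_le_iff_inner u_def by (auto simp: inner_diff_left)
    ultimately show False by blast
  qed

  have aff: "aff_dim (\<Inter>t\<in>S. screw t ` P) = int k + 1" if S: "S \<subseteq> T" "card S = Suc k" for S
  proof -
    have finS: "finite S" using S(1) finT finite_subset by blast
    define E where "E = {x. \<forall>s\<in>S. \<forall>t\<in>S. dist x (curve s) = dist x (curve t)}"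
    \<comment> \<open>The intersection is caught between \<open>E \<inter> N\<close> and E, which
      have equal dimension as N is open and meets E in \<open>X S\<close>. N makes the inequalities
      against points outside S strict; \<open>X S\<close> satisfies them because its empty sphere
      covers the whole window.\<close>
    define N where "N = (\<Inter>t\<in>S. \<Inter>j\<in>{j \<in> J. t + j \<notin> S}. {x. dist x (curve t) < dist x (curve (t + j))}) \<inter>
      (\<Inter>t\<in>S. ball (screw t 0) M)"
    have XE: "X S \<in> E" unfolding E_def using X(1)[OF S] by auto
    have "S \<subseteq> {lo..hi}" using S(1) T_sub by blast
    then have E: "affine E" "aff_dim E = int k + 1"
      using equidistant_aff_dim[OF finS S(2) _ len2 XE[unfolded E_def]] unfolding E_def by blast+
    have "open N"
      unfolding N_def using finS finJ
      by (intro open_Int open_INT ballI open_Collect_less continuous_intros open_ball) auto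
    have "X S \<in> N"
      unfolding N_def using X(1)[OF S] X(2)[OF S] TJ M[OF S(1)] S(1)
      by (auto simp: dist_commute[of _ "X S"])
    have sub1: "(\<Inter>t\<in>S. screw t ` P) \<subseteq> E"
    proof
      fix x assume x: "x \<in> (\<Inter>t\<in>S. screw t ` P)"
      have "dist x (curve s) \<le> dist x (curve t)" if "s \<in> S" "t \<in> S" for s t
      proof (cases "s = t")
        case False
        then have "t - s \<in> J" using diffT(1) that S(1) by blast
        then show ?thesis using closer[of x s "t - s"] x that by auto
      qed simp
      then show "x \<in> E" unfolding E_def by (auto intro: antisym)
    qed
    have sub2: "E \<inter> N \<subseteq> (\<Inter>t\<in>S. screw t ` P)"
    proof (intro subsetI INT_I)
      fix x t assume x: "x \<in> E \<inter> N" and t: "t \<in> S"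
      show "x \<in> screw t ` P"
      proof (rule memI)
        show "dist x (screw t 0) < M" using x t by (auto simp: N_def dist_commute)
        fix j assume j: "j \<in> J"
        show "dist x (curve t) \<le> dist x (curve (t + j))"
        proof (cases "t + j \<in> S")
          case True
          then have "dist x (curve t) = dist x (curve (t + j))" using x t unfolding E_def by blast
          then show ?thesis by simp
        next
          case False
          then have "dist x (curve t) < dist x (curve (t + j))" using x t j unfolding N_def by blast
          then show ?thesis by simp
        qed
      qed
    qed
    have "aff_dim (E \<inter> N) = aff_dim E"
      using XE \<open>X S \<in> N\<close> by (intro aff_dim_convex_Int_open affine_imp_convex E \<open>open N\<close>) blast
    then show ?thesis
      using aff_dim_subset[OF sub1] aff_dim_subset[OF sub2] E(2) by simp
  qed

  \<comment> \<open>A common point is equidistant from k + 2 centres and no closer to the grid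
    points next to them, which is what \<open>dist_square_window\<close> excludes.\<close>
  have disj: "(\<Inter>t\<in>S. screw t ` P) = {}" if S: "S \<subseteq> T" "card S = k + 2" for S
  proof (rule ccontr)
    assume "\<not> ?thesis"
    then obtain x where x: "\<And>t. t \<in> S \<Longrightarrow> x \<in> screw t ` P" by auto
    obtain t0 where t0: "t0 \<in> S" using S(2) by fastforce
    show False
    proof (rule dist_square_window)
      show "finite S" using S(1) finT finite_subset by blast
      show "card S = k + 2" by (rule S(2))
      show "2 * \<epsilon> < \<bar>s - t\<bar>" if "s \<in> S" "t \<in> S" "s \<noteq> t" for s t
        using diffT(2) that S(1) by blast
      show "lo \<le> t - \<epsilon> \<and> t + \<epsilon> \<le> hi" if "t \<in> S" for t
        using TJ[of t \<epsilon>] TJ[of t "- \<epsilon>"] J\<epsilon> that S(1) by auto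
      have le: "dist x (curve s) \<le> dist x (curve t)" if "s \<in> S" "t \<in> S" for s t
      proof (cases "s = t")
        case False
        then have "t - s \<in> J" using diffT(1) that S(1) by blast
        then show ?thesis using closer[of x s "t - s"] x that by auto
      qed simp
      show eq: "dist x (curve t) = dist x (curve t0)" if "t \<in> S" for t
        using le[OF that t0] le[OF t0 that] by simp
      show "dist x (curve t0) \<le> dist x (curve (t - \<epsilon>))" "dist x (curve t0) \<le> dist x (curve (t + \<epsilon>))"
        if "t \<in> S" for t
        using closer[OF x[OF that] J\<epsilon>(1)] closer[OF x[OF that] J\<epsilon>(2)] eq[OF that] by simp_all
    qed (rule \<epsilon>, rule len2)
  qed

  have "congruent_sets (screw s ` P) (screw t ` P)" for s t
    unfolding congruent_sets_def
  proof (intro exI conjI)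
    show "isometry (screw t \<circ> screw (- s))" by (simp add: isometry_def)
    show "(screw t \<circ> screw (- s)) ` screw s ` P = screw t ` P" by (simp add: image_image)
  qed
  moreover have "neighborly (k + 1) ((\<lambda>t. screw t ` P) ` T)"
    unfolding neighborly_def
  proof (intro conjI allI impI)
    fix G assume G: "G \<subseteq> (\<lambda>t. screw t ` P) ` T \<and> finite G \<and> card G = k + 1"
    then obtain S where S: "S \<subseteq> T" "inj_on (\<lambda>t. screw t ` P) S" "G = (\<lambda>t. screw t ` P) ` S"
      unfolding subset_image_inj by blast
    then show "aff_dim (\<Inter>G) = int DIM('a) - int (k + 1) + 1"
      using G aff[of S] card_image[OF S(2)] by (simp add: DIM_eq)
  next
    fix G assume G: "G \<subseteq> (\<lambda>t. screw t ` P) ` T \<and> finite G \<and> card G = k + 1 + 1"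
    then obtain S where S: "S \<subseteq> T" "inj_on (\<lambda>t. screw t ` P) S" "G = (\<lambda>t. screw t ` P) ` S"
      unfolding subset_image_inj by blast
    then show "\<Inter>G = {}"
      using G disj[of S] card_image[OF S(2)] by simp
  qed
  moreover have "convex_polytope (screw t ` P)" "flat r (screw t ` f)" "symmetric_about (screw t ` P) (screw t ` f)" for t
    using convex_polytope_isometry_image flat_isometry_image symmetric_about_isometry_image isometry_screw P(1) f
    by blast+
  moreover have "card ((\<lambda>t. screw t ` P) ` T) = n"
    using card_image[OF inj] cardT by simp
  ultimately show ?thesis
    using finT by (intro exI[of _ "(\<lambda>t. screw t ` P) ` T"]) blast
qed

end

theorem theorem7:
  fixes k n r :: nat
  assumes "k \<ge> 1" and "n \<ge> 1" and "r \<le> 2 * k"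
    and "CARD('d::finite) = 2 * k + 1"
  shows "\<exists>F :: (real ^ 'd) set set.
           finite F \<and> card F = n \<and>
           (\<forall>P\<in>F. convex_polytope P) \<and>
           (\<forall>P\<in>F. \<forall>Q\<in>F. congruent_sets P Q) \<and>
           neighborly (k + 1) F \<and>
           (\<forall>P\<in>F. \<exists>f. flat r f \<and> symmetric_about P f)"
proof -
  have "card {..2 * k} = card (Basis :: (real ^ 'd) set)"
    using assms(4) by simp
  then obtain e :: "nat \<Rightarrow> real ^ 'd" where "bij_betw e {..2 * k} Basis"
    using finite_same_card_bij[of "{..2 * k}" "Basis :: (real ^ 'd) set"] by auto
  then interpret helix e k by unfold_locales
  show ?thesis by (rule neighborly_family_exists[OF assms(1-3)])
qed

end
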